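(* Let $d\ge3$. There are constants $c_1>c_2>0$ and positive constants $c,c'$ (possibly different at each occurrence), all depending only on $d$, such that for all $u>0$ and integers $N\ge1$, with $k^*=[c_1uN^{d-2}]$ and $k_*=[c_2uN^{d-2}]$, $$P[\mathcal R_{k^*}\le uN^d]\le c\,\exp\{-c'uN^{d-2}\},$$ $$P[\mathcal R_{k_*}\ge uN^d]\le c\,\exp\{-c'uN^{d-2}\}.$$ Moreover there are constants $c,c'>0$ depending only on $d$ such that for every $u>0$, $$e^{-cu}\le\liminf_{N\to\infty}P[0\notin X_{[0,uN^d]}]\le\limsup_{N\to\infty}P[0\notin X_{[0,uN^d]}]\le e^{-c'u}.$$
   Context: $[\cdot]$ denotes integer part. $E=(\mathbb Z/N\mathbb Z)^d$ is the discrete torus, $\pi_E:\mathbb Z^d\to E$ the canonical projection. $P$ is the law of simple random walk $(X_n)_{n\ge0}$ on $E$ (each step adds one of $\pm e_1,\dots,\pm e_d$ with probability $1/(2d)$, where $(e_i)$ is the canonical basis) started from the uniform distribution. $X_{[0,t]}=\{X_n:0\le n\le t\}$. Set $$B=\pi_E\big([-\tfrac N8,\tfrac N8]^d\cap\mathbb Z^d\big)\subseteq\tilde B=\pi_E\big([-\tfrac N4,\tfrac N4]^d\cap\mathbb Z^d\big).$$ $\mathcal R_k,\mathcal D_k$ are the successive returns to $B$ and departures from $\tilde B$: $\mathcal R_0=\mathcal D_0=0$ by convention, $\mathcal R_1=\inf\{n\ge0:X_n\in B\}$, and for $k\ge1$, $\mathcal D_k=\inf\{n\ge\mathcal R_k:X_n\notin\tilde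 B\}$, $\mathcal R_{k+1}=\inf\{n\ge\mathcal D_k:X_n\in B\}$.
   Formalization: The second inequality is stated for N ≥ 2 instead of N ≥ 1: for N = 1 the torus is a single point, so D_1 and all R_k with k ≥ 2 are infinite, and the printed bound fails for large u. *)

theory Defs
  imports "HOL-Probability.Probability"
begin

text \<open>
  The dimension is \<open>d = CARD('d)\<close>.  A point of the torus \<open>(\<int>/N\<int>)\<^sup>d\<close> is represented by its
  unique lift to \<open>\<int>\<^sup>d\<close> with coordinates in \<open>{0..<N}\<close>; in particular the origin is \<open>0\<close>.
\<close>

definition torus :: "nat \<Rightarrow> (int ^ 'd) set" where
  "torus N = {x. \<forall>i. x $ i \<in> {0..<int N}}"

definition torus_proj :: "nat \<Rightarrow> int ^ 'd \<Rightarrow> int ^ 'd" where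
  "torus_proj N x = (\<chi> i. x $ i mod int N)"

definition unit_steps :: "(int ^ 'd) set" where
  "unit_steps = (\<Union>i. {axis i 1, - axis i 1})"

text \<open>
  Law on path space of simple random walk on the torus with uniform starting point.  The i.i.d.
  steps are drawn in \<open>\<int>\<^sup>d\<close>, where the \<open>2d\<close> vectors \<open>e\<^sub>i\<close>, \<open>-e\<^sub>i\<close> are distinct, and then
  projected: for \<open>N = 2\<close> the images of \<open>e\<^sub>i\<close> and \<open>-e\<^sub>i\<close> coincide and carry their joint mass.
\<close>

definition torus_walk :: "nat \<Rightarrow> (nat \<Rightarrow> int ^ 'd) measure" where
  "torus_walk N =
     distr (measure_pmf (pmf_of_set (torus N)) \<Otimes>\<^sub>M (\<Pi>\<^sub>M k\<in>UNIV. measure_pmf (pmf_of_set unit_steps)))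
       (\<Pi>\<^sub>M n\<in>UNIV. count_space UNIV)
       (\<lambda>(x, \<xi>) n. torus_proj N (x + (\<Sum>k<n. \<xi> k)))"

definition box_B :: "nat \<Rightarrow> (int ^ 'd) set" where
  "box_B N = torus_proj N ` {x. \<forall>i. real_of_int (x $ i) \<in> {- real N / 8 .. real N / 8}}"

definition box_B_tilde :: "nat \<Rightarrow> (int ^ 'd) set" where
  "box_B_tilde N = torus_proj N ` {x. \<forall>i. real_of_int (x $ i) \<in> {- real N / 4 .. real N / 4}}"

text \<open>The infimum is taken in \<^typ>\<open>enat\<close>, so it is \<open>\<infinity>\<close> when there is no such time.\<close>

definition first_time_from :: "enat \<Rightarrow> 'a set \<Rightarrow> (nat \<Rightarrow> 'a) \<Rightarrow> enat" where
  "first_time_from s A X = Inf {enat n | n. s \<le> enat n \<and> X n \<in> A}"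

fun return_time :: "nat \<Rightarrow> nat \<Rightarrow> (nat \<Rightarrow> int ^ 'd) \<Rightarrow> enat"
  and departure_time :: "nat \<Rightarrow> nat \<Rightarrow> (nat \<Rightarrow> int ^ 'd) \<Rightarrow> enat" where
  "return_time N 0 X = 0"
| "return_time N (Suc k) X = first_time_from (departure_time N k X) (box_B N) X"
| "departure_time N 0 X = 0"
| "departure_time N (Suc k) X = first_time_from (return_time N (Suc k) X) (- box_B_tilde N) X"

definition visited :: "real \<Rightarrow> (nat \<Rightarrow> 'a) \<Rightarrow> 'a set" where
  "visited t X = {X n | n. real n \<le> t}"

end

theory Submission
  imports Defs "HOL-Real_Asymp.Real_Asymp"
begin

text \<open>
  All bounds come from functions of the current position that are contracted, or expanded only
  slightly, by the one-step average of the walk; no Green function asymptotics are needed.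

  The returns to \<open>B\<close> are counted by an automaton with two phases, "towards the complement of the
  larger box" and "towards \<open>B\<close>".  With \<open>k\<close> the number of returns so far, the exponential
  supermartingale \<open>2^k * \<Sum>i. exp (- l * cos (2\<pi>x\<^sub>i/N))\<close> (replaced by \<open>2^k\<close> in the second phase) grows by
  a factor \<open>exp (O(1/N\<^sup>2))\<close> per step and bounds the probability of many returns.  For few returns one
  uses \<open>M^(-k) * G\<close> with \<open>G\<close> contracted by a factor \<open>1 - s/N\<^sup>2\<close>: towards the complement of the
  larger box \<open>G\<close> is an explicit cosine sum, and towards \<open>B\<close> it solves a Poisson equation whose
  right-hand side is a trigonometric polynomial concentrated in \<open>B\<close>.

  For the origin, \<open>P[H\<^sub>0 > 2k]\<close> is log-convex in \<open>k\<close>, since the walk killed at \<open>0\<close> is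
  reversible.  Its first ratio \<open>1 - O(N\<^sup>-\<^sup>d)\<close> gives the lower bound.  The upper bound follows from any
  estimate \<open>C * (1 - c N\<^sup>-\<^sup>d)^n\<close>, because log-convexity removes the constant \<open>C\<close>; such an estimate holds
  because the Poisson equation with a point mass at \<open>0\<close> has a bounded solution after scaling by \<open>N\<^sup>-\<^sup>d\<close>,
  which is where \<open>d \<ge> 3\<close> is used.
\<close>

section \<open>One-step averages and the first-step decomposition\<close>

text \<open>Test functions live on the lift Z^d and are periodic, so one-step averages need no
  reduction modulo N and N = 2 is no exception for the kernel. Cosines fit the problem because the
  two boxes are exactly the sets where every cos(2 pi x_i / N) is at least sqrt 2 / 2, respectively
  at least 0. Time u N^d consists of u N^(d-2) stretches of length N^2. A rate of order 1/N^2 per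
  step, set against a fixed factor per return, therefore gives exponents proportional to u N^(d-2).
  The bound for few returns requires N at least 2: for N = 1 the larger box is the whole torus, no
  departure ever happens, the second return time is infinite and the estimate fails for large u. For
  the origin a prefactor above 1 would ruin the bound e^(-c'u) for small u, hence the care to remove
  it. Cauchy-Schwarz gives log-convexity along even times only, since the killed kernel may have
  negative eigenvalues, so times are rounded to even numbers. No mixing enters, so the periodicity
  of the walk for even N needs no separate treatment.\<close>

definition avg :: "(int ^ 'd \<Rightarrow> real) \<Rightarrow> int ^ 'd \<Rightarrow> real" where
  "avg f x = (\<Sum>i\<in>UNIV. f (x + axis i 1) + f (x - axis i 1)) / (2 * real CARD('d::finite))"

abbreviation step_space :: "(nat \<Rightarrow> int ^ 'd) measure" where
  "step_space \<equiv> \<Pi>\<^sub>M k\<in>UNIV. measure_pmf (pmf_of_set unit_steps)"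

abbreviation path_space :: "(nat \<Rightarrow> int ^ 'd) measure" where
  "path_space \<equiv> \<Pi>\<^sub>M n\<in>UNIV. count_space UNIV"

text \<open>The starting point is any lift in Z^d. After a step \<open>e\<close> the remaining path
  is again of this form, started from \<open>x + e\<close> without projecting first.\<close>

definition walk_from :: "nat \<Rightarrow> int ^ 'd \<Rightarrow> (nat \<Rightarrow> int ^ 'd) measure" where
  "walk_from N x = distr step_space path_space (\<lambda>\<xi> n. torus_proj N (x + (\<Sum>k<n. \<xi> k)))"

section \<open>Torus points, unit steps and measurability of the walk\<close>

lemma torus_proj_eq_iff:
  "torus_proj N x = torus_proj N y \<longleftrightarrow> (\<forall>i. x $ i mod int N = y $ i mod int N)"
  by (simp add: torus_proj_def vec_eq_iff)

lemma torus_proj_add: "torus_proj N (torus_proj N x + y) = torus_proj N (x + y)"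
  by (simp add: torus_proj_def vec_eq_iff mod_simps)

lemma torus_proj_idem [simp]: "torus_proj N (torus_proj N x) = torus_proj N x"
  by (simp add: torus_proj_def vec_eq_iff)

lemma torus_proj_in_torus: "N \<ge> 1 \<Longrightarrow> torus_proj N x \<in> torus N"
  by (simp add: torus_proj_def torus_def)

lemma torus_proj_id: "x \<in> torus N \<Longrightarrow> torus_proj N x = x"
  by (simp add: torus_proj_def torus_def vec_eq_iff)

lemma sum_unit_steps:
  fixes f :: "int ^ 'd::finite \<Rightarrow> 'a::comm_monoid_add"
  shows "(\<Sum>e\<in>unit_steps. f e) = (\<Sum>i\<in>UNIV. f (axis i 1) + f (- axis i 1))"
proof -
  have ne: "axis i 1 \<noteq> - axis j (1::int)" for i j :: 'd
  proof
    assume "axis i 1 = - axis j (1::int)"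
    then have "axis i 1 $ i = (- axis j (1::int)) $ i" by simp
    then show False by (simp add: axis_def split: if_splits)
  qed
  have inj: "axis i 1 = axis j (1::int) \<longleftrightarrow> i = j" for i j :: 'd
    by (simp add: axis_eq_axis)
  have "(\<Sum>e\<in>unit_steps. f e) = (\<Sum>i\<in>UNIV. \<Sum>e\<in>{axis i 1, - axis i 1}. f e)"
    unfolding unit_steps_def
    by (rule sum.UNION_disjoint) (auto simp: ne ne[symmetric] inj)
  also have "\<dots> = (\<Sum>i\<in>UNIV. f (axis i 1) + f (- axis i 1))"
    by (intro sum.cong) (auto simp: ne)
  finally show ?thesis .
qed

lemma finite_unit_steps: "finite (unit_steps :: (int ^ 'd::finite) set)"
  by (simp add: unit_steps_def)

lemma unit_steps_nonempty: "(unit_steps :: (int ^ 'd::finite) set) \<noteq> {}"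
  by (auto simp: unit_steps_def)

lemma card_unit_steps: "card (unit_steps :: (int ^ 'd::finite) set) = 2 * CARD('d)"
  using sum_unit_steps[of "\<lambda>_::int^'d. 1::nat"] by simp

lemma avg_unit_steps:
  fixes f :: "int ^ 'd::finite \<Rightarrow> real"
  shows "avg f x = (\<Sum>e\<in>unit_steps. f (x + e)) / real (card (unit_steps :: (int ^ 'd) set))"
  by (simp add: avg_def sum_unit_steps card_unit_steps)

lemma finite_torus: "finite (torus N :: (int ^ 'd::finite) set)"
  and card_torus: "card (torus N :: (int ^ 'd::finite) set) = N ^ CARD('d)"
proof -
  have bij: "bij_betw (\<lambda>x i. x $ i) (torus N :: (int ^ 'd) set) (PiE UNIV (\<lambda>_. {0..<int N}))"
    by (rule bij_betwI[where g = "\<lambda>f. \<chi> i. f i"]) (auto simp: torus_def PiE_UNIV_domain)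
  have "finite (PiE (UNIV :: 'd set) (\<lambda>_. {0..<int N}))"
    by (rule finite_PiE) auto
  then show "finite (torus N :: (int ^ 'd) set)"
    using bij by (simp add: bij_betw_finite)
  show "card (torus N :: (int ^ 'd::finite) set) = N ^ CARD('d)"
    using bij_betw_same_card[OF bij] by (simp add: card_PiE)
qed

lemma torus_nonempty: "N \<ge> 1 \<Longrightarrow> (torus N :: (int ^ 'd) set) \<noteq> {}"
  using torus_proj_in_torus by blast

lemma measurable_step_sum [measurable]:
  "(\<lambda>\<xi>. x + (\<Sum>k<n. \<xi> k)) \<in> (step_space :: (nat \<Rightarrow> int ^ 'd::finite) measure) \<rightarrow>\<^sub>M count_space UNIV"
proof (induction n)
  case 0
  then show ?case by simp
next
  case (Suc n)
  have pr: "(\<lambda>\<xi>. \<xi> n) \<in> (step_space :: (nat \<Rightarrow> int ^ 'd::finite) measure) \<rightarrow>\<^sub>M count_space UNIV"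
    using measurable_component_singleton[of n UNIV "\<lambda>_. measure_pmf (pmf_of_set unit_steps) :: (int^'d) measure"]
    by (simp add: measurable_def)
  have "(\<lambda>\<xi>. (\<lambda>y \<xi>. y + \<xi> n) (x + (\<Sum>k<n. \<xi> k)) \<xi>) \<in> step_space \<rightarrow>\<^sub>M count_space UNIV"
    by (rule measurable_compose_countable[OF _ Suc])
       (rule measurable_compose[OF pr], simp)
  then show ?case by (simp add: add.assoc)
qed

lemma measurable_walk [measurable]:
  "(\<lambda>\<xi> n. torus_proj N (x + (\<Sum>k<n. \<xi> k))) \<in> (step_space :: (nat \<Rightarrow> int ^ 'd::finite) measure) \<rightarrow>\<^sub>M path_space"
  by (rule measurable_PiM_single')
     (auto intro!: measurable_compose[OF measurable_step_sum[of x]])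

lemma measurable_case_nat_path [measurable]:
  "(\<lambda>X. case_nat x X) \<in> path_space \<rightarrow>\<^sub>M (path_space :: (nat \<Rightarrow> int ^ 'd::finite) measure)"
proof (rule measurable_PiM_single')
  fix i :: nat
  show "(\<lambda>X. case i of 0 \<Rightarrow> x | Suc m \<Rightarrow> X m) \<in> path_space \<rightarrow>\<^sub>M count_space UNIV"
    by (cases i) (auto intro: measurable_component_singleton)
qed auto

lemma nn_integral_pmf_of_set_real:
  assumes "finite A" "A \<noteq> {}"
  shows "(\<integral>\<^sup>+x. f x \<partial>measure_pmf (pmf_of_set A)) = (\<Sum>x\<in>A. f x) * ennreal (1 / real (card A))"
  using assms
  by (subst nn_integral_measure_pmf_support[of A])
     (auto simp: pmf_of_set sum_distrib_right)

lemma sequence_space_steps: "sequence_space (measure_pmf (pmf_of_set unit_steps) :: (int ^ 'd::finite) measure)"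
  by (simp add: sequence_space_def product_prob_space_def product_sigma_finite_def
        product_prob_space_axioms_def prob_space_measure_pmf measure_pmf.sigma_finite_measure_axioms)

text \<open>The Markov property at time 1. \<open>PiM_iter\<close> splits the first step off the
  i.i.d. sequence, and the shifted partial sums are those of the walk from
  \<open>x + e\<close>.\<close>

lemma nn_integral_walk_from_Suc:
  fixes x :: "int ^ 'd::finite"
  assumes F [measurable]: "F \<in> borel_measurable path_space"
  shows "(\<integral>\<^sup>+X. F X \<partial>walk_from N x) =
    (\<Sum>e\<in>unit_steps. \<integral>\<^sup>+X. F (case_nat (torus_proj N x) X) \<partial>walk_from N (x + e))
      * ennreal (1 / real (card (unit_steps :: (int ^ 'd) set)))"
proof -
  let ?p = "measure_pmf (pmf_of_set unit_steps) :: (int ^ 'd) measure"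
  let ?w = "\<lambda>x \<xi> n. torus_proj N (x + (\<Sum>k<n. \<xi> k)) :: int ^ 'd"
  interpret sequence_space ?p by (rule sequence_space_steps)
  have mF: "(\<lambda>\<xi>. F (?w x \<xi>)) \<in> borel_measurable step_space" by measurable
  have split: "?w x (case_nat e \<xi>) = case_nat (torus_proj N x) (?w (x + e) \<xi>)" for e \<xi>
  proof
    fix n show "?w x (case_nat e \<xi>) n = case_nat (torus_proj N x) (?w (x + e) \<xi>) n"
      by (cases n) (simp_all add: sum.lessThan_Suc_shift add.assoc del: sum.lessThan_Suc)
  qed
  have "(\<integral>\<^sup>+X. F X \<partial>walk_from N x) = (\<integral>\<^sup>+\<xi>. F (?w x \<xi>) \<partial>S)"
    unfolding walk_from_def by (subst nn_integral_distr) auto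
  also have "\<dots> = (\<integral>\<^sup>+z. F (?w x z) \<partial>distr (?p \<Otimes>\<^sub>M S) S (\<lambda>(s, \<omega>). case_nat s \<omega>))"
    by (subst PiM_iter) simp
  also have "\<dots> = (\<integral>\<^sup>+z. F (?w x (case z of (s, \<omega>) \<Rightarrow> case_nat s \<omega>)) \<partial>(?p \<Otimes>\<^sub>M S))"
    by (rule nn_integral_distr) (use mF in measurable)
  also have "\<dots> = (\<integral>\<^sup>+e. \<integral>\<^sup>+\<xi>. F (?w x (case_nat e \<xi>)) \<partial>S \<partial>?p)"
    using measurable_compose[of "\<lambda>(s, \<omega>). case_nat s \<omega>" "?p \<Otimes>\<^sub>M S" S, OF _ mF]
    by (subst P.nn_integral_fst[symmetric]) (auto simp: case_prod_beta)
  also have "\<dots> = (\<integral>\<^sup>+e. \<integral>\<^sup>+X. F (case_nat (torus_proj N x) X) \<partial>walk_from N (x + e) \<partial>?p)"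
    unfolding split walk_from_def
    by (subst nn_integral_distr) auto
  also have "\<dots> = (\<Sum>e\<in>unit_steps. \<integral>\<^sup>+X. F (case_nat (torus_proj N x) X) \<partial>walk_from N (x + e))
      * ennreal (1 / real (card (unit_steps :: (int ^ 'd) set)))"
    by (rule nn_integral_pmf_of_set_real[OF finite_unit_steps unit_steps_nonempty])
  finally show ?thesis .
qed

lemma sets_walk_from [measurable_cong, simp]: "sets (walk_from N x) = sets path_space"
  by (simp add: walk_from_def)

lemma sets_torus_walk [measurable_cong, simp]: "sets (torus_walk N) = sets path_space"
  by (simp add: torus_walk_def)

lemma space_torus_walk [simp]: "space (torus_walk N) = UNIV"
  by (simp add: torus_walk_def space_PiM)

lemma prob_space_walk_from: "prob_space (walk_from N (x :: int ^ 'd::finite))"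
  unfolding walk_from_def
  by (rule prob_space.prob_space_distr[OF prob_space_PiM]) (auto simp: prob_space_measure_pmf)

lemma nn_integral_torus_walk:
  assumes N: "N \<ge> 1" and F [measurable]: "F \<in> borel_measurable (path_space :: (nat \<Rightarrow> int ^ 'd::finite) measure)"
  shows "(\<integral>\<^sup>+X. F X \<partial>torus_walk N) =
    (\<Sum>x\<in>(torus N :: (int ^ 'd) set). \<integral>\<^sup>+X. F X \<partial>walk_from N x) * ennreal (1 / real N ^ CARD('d))"
proof -
  let ?p = "measure_pmf (pmf_of_set (torus N)) :: (int ^ 'd) measure"
  let ?w = "\<lambda>x \<xi> n. torus_proj N (x + (\<Sum>k<n. \<xi> k)) :: int ^ 'd"
  interpret S: prob_space "step_space :: (nat \<Rightarrow> int ^ 'd) measure"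
    by (rule prob_space_PiM) (auto simp: prob_space_measure_pmf)
  have mw: "(\<lambda>(x, \<xi>). ?w x \<xi>) \<in> (?p \<Otimes>\<^sub>M step_space) \<rightarrow>\<^sub>M path_space"
    unfolding case_prod_beta
  proof (rule measurable_compose_countable[where g = fst and f = "\<lambda>x z. ?w x (snd z)"])
    show "(\<lambda>z. ?w x (snd z)) \<in> (?p \<Otimes>\<^sub>M step_space) \<rightarrow>\<^sub>M path_space" for x
      by (rule measurable_compose[OF measurable_snd measurable_walk])
    show "fst \<in> (?p \<Otimes>\<^sub>M step_space) \<rightarrow>\<^sub>M count_space UNIV"
      using measurable_fst[of ?p step_space] by (simp add: measurable_def)
  qed
  have "(\<integral>\<^sup>+X. F X \<partial>torus_walk N) = (\<integral>\<^sup>+z. F (case z of (x, \<xi>) \<Rightarrow> ?w x \<xi>) \<partial>(?p \<Otimes>\<^sub>M step_space))"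
    unfolding torus_walk_def by (rule nn_integral_distr[OF mw]) simp
  also have "\<dots> = (\<integral>\<^sup>+x. \<integral>\<^sup>+\<xi>. F (?w x \<xi>) \<partial>step_space \<partial>?p)"
    using measurable_compose[OF mw F]
    by (subst S.nn_integral_fst[symmetric]) (auto simp: case_prod_beta)
  also have "\<dots> = (\<integral>\<^sup>+x. \<integral>\<^sup>+X. F X \<partial>walk_from N x \<partial>?p)"
    unfolding walk_from_def by (subst nn_integral_distr) auto
  also have "\<dots> = (\<Sum>x\<in>torus N. \<integral>\<^sup>+X. F X \<partial>walk_from N x) * ennreal (1 / real N ^ CARD('d))"
    by (subst nn_integral_pmf_of_set_real[OF finite_torus torus_nonempty[OF N]]) (simp add: card_torus)
  finally show ?thesis .
qed

lemma prob_space_torus_walk: "prob_space (torus_walk N :: (nat \<Rightarrow> int ^ 'd::finite) measure)" if "N \<ge> 1"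
proof (rule prob_spaceI)
  have "emeasure (torus_walk N :: (nat \<Rightarrow> int ^ 'd) measure) (space (torus_walk N))
      = (\<integral>\<^sup>+X. 1 \<partial>(torus_walk N :: (nat \<Rightarrow> int ^ 'd) measure))"
    by simp
  also have "\<dots> = (\<Sum>x\<in>(torus N :: (int ^ 'd) set). 1) * ennreal (1 / real N ^ CARD('d))"
    by (subst nn_integral_torus_walk[OF that])
       (auto simp: prob_space.emeasure_space_1[OF prob_space_walk_from])
  also have "\<dots> = 1"
    using that by (simp add: card_torus ennreal_of_nat_eq_real_of_nat ennreal_mult[symmetric] del: of_nat_power)
  finally show "emeasure (torus_walk N :: (nat \<Rightarrow> int ^ 'd) measure) (space (torus_walk N)) = 1" .
qed

section \<open>Return times through a two-state automaton\<close>

lemma first_time_from_le_iff: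
  "first_time_from s A X \<le> enat n \<longleftrightarrow> (\<exists>m\<le>n. s \<le> enat m \<and> X m \<in> A)"
proof
  assume "first_time_from s A X \<le> enat n"
  then have "Inf {enat n |n. s \<le> enat n \<and> X n \<in> A} < enat (Suc n)"
    unfolding first_time_from_def
    by (meson enat_ord_simps(2) le_less_trans lessI)
  then show "\<exists>m\<le>n. s \<le> enat m \<and> X m \<in> A"
    unfolding Inf_less_iff by (auto simp: less_Suc_eq_le)
next
  assume "\<exists>m\<le>n. s \<le> enat m \<and> X m \<in> A"
  then obtain m where "m \<le> n" "s \<le> enat m" "X m \<in> A" by blast
  then have "first_time_from s A X \<le> enat m"
    unfolding first_time_from_def by (intro Inf_lower) auto
  then show "first_time_from s A X \<le> enat n"
    using \<open>m \<le> n\<close> by (meson enat_ord_simps(1) order_trans)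
qed

lemma first_time_from_ge: "s \<le> first_time_from s A X"
  unfolding first_time_from_def by (intro Inf_greatest) auto

lemma box_B_subset: "box_B N \<subseteq> box_B_tilde N"
  unfolding box_B_def box_B_tilde_def
proof (intro image_mono subsetI CollectI allI)
  fix x :: "int ^ 'd" and i
  assume "x \<in> {x. \<forall>i. real_of_int (x $ i) \<in> {- real N / 8..real N / 8}}"
  then have "real_of_int (x $ i) \<in> {- real N / 8..real N / 8}" by blast
  then show "real_of_int (x $ i) \<in> {- real N / 4..real N / 4}" by auto
qed

text \<open>
  The pair \<open>(k, b)\<close> records the number \<open>k\<close> of returns to \<open>B\<close> so far and whether the walk is
  currently in the phase between a return to \<open>B\<close> and the next departure from the larger box.
\<close>

definition cycle_step :: "nat \<Rightarrow> nat \<times> bool \<Rightarrow> int ^ 'd \<Rightarrow> nat \<times> bool" where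
  "cycle_step N s y =
     (if snd s then (fst s, y \<in> box_B_tilde N)
      else if y \<in> box_B N then (Suc (fst s), True) else (fst s, False))"

text \<open>The argument \<open>s\<close> is the state before time 0, so index 0 has already read
  \<open>X 0\<close>. Started from \<open>(0, False)\<close>, a walk that begins in B counts a
  return at time 0, as the definition of the first return demands.\<close>

primrec cycle_state :: "nat \<Rightarrow> nat \<times> bool \<Rightarrow> (nat \<Rightarrow> int ^ 'd) \<Rightarrow> nat \<Rightarrow> nat \<times> bool" where
  "cycle_state N s X 0 = cycle_step N s (X 0)"
| "cycle_state N s X (Suc n) = cycle_step N (cycle_state N s X n) (X (Suc n))"

lemma cycle_state_case_nat:
  "cycle_state N s (case_nat y X) (Suc n) = cycle_state N (cycle_step N s y) X n"
  by (induction n) simp_all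

lemma snd_cycle_step:
  "snd (cycle_step N s y) \<Longrightarrow> y \<in> box_B_tilde N"
  "\<not> snd (cycle_step N s y) \<Longrightarrow> y \<notin> box_B N"
  using box_B_subset by (auto simp: cycle_step_def split: if_splits)

lemma return_departure_mono:
  "return_time N k X \<le> departure_time N k X"
  "departure_time N k X \<le> return_time N (Suc k) X"
  by (cases k; simp add: first_time_from_ge)+

lemma mono_return_time: "j \<le> k \<Longrightarrow> return_time N j X \<le> return_time N k X"
  by (rule lift_Suc_mono_le[of "\<lambda>k. return_time N k X"])
     (meson order_trans return_departure_mono)

text \<open>Invariant locating time n between consecutive return and departure times. One step
  crosses at most one of them, because B lies inside the larger box: a departure and the following
  return cannot coincide, nor can a return and the following departure. The convention
  \<open>departure_time N 0 X = 0\<close> makes the invariant consistent with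
  \<open>k = 0\<close>.\<close>

lemma cycle_state_0_bounds:
  fixes N :: nat and X :: "nat \<Rightarrow> int ^ 'd"
  defines "s \<equiv> \<lambda>X. cycle_state N (0, False) (X :: nat \<Rightarrow> int ^ 'd)"
  shows "if snd (s X n)
    then return_time N (fst (s X n)) X \<le> enat n \<and> enat n < departure_time N (fst (s X n)) X
    else departure_time N (fst (s X n)) X \<le> enat n \<and> enat n < return_time N (Suc (fst (s X n))) X"
proof (induction n)
  case 0
  show ?case
  proof (cases "X 0 \<in> box_B N")
    case True
    then have "return_time N 1 X \<le> enat 0"
      by (simp add: first_time_from_le_iff)
    moreover have "\<not> departure_time N 1 X \<le> enat 0"
      using True box_B_subset by (auto simp: first_time_from_le_iff)
    ultimately show ?thesis using True by (simp add: s_def cycle_step_def not_le)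
  next
    case False
    then have "\<not> return_time N 1 X \<le> enat 0"
      by (simp add: first_time_from_le_iff)
    then show ?thesis using False by (simp add: s_def cycle_step_def not_le)
  qed
next
  case (Suc n)
  define K where "K = fst (s X n)"
  have later: "\<not> t \<le> enat n \<Longrightarrow> t \<le> enat (Suc n) \<Longrightarrow> t = enat (Suc n)" for t
    by (cases t) auto
  have early: "t \<le> enat n \<Longrightarrow> t \<le> enat (Suc n)" for t
    by (cases t) auto
  show ?case
  proof (cases "snd (s X n)")
    case True
    then have IH: "return_time N K X \<le> enat n" "enat n < departure_time N K X"
      using Suc by (auto simp: K_def)
    then obtain k where k: "K = Suc k" by (cases K) auto
    show ?thesis
    proof (cases "X (Suc n) \<in> box_B_tilde N")
      case T: True
      then have "s X (Suc n) = (K, True)"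
        using True by (simp add: s_def K_def cycle_step_def)
      moreover have "\<not> departure_time N K X \<le> enat (Suc n)"
      proof
        assume "departure_time N K X \<le> enat (Suc n)"
        then obtain m where m: "m \<le> Suc n" "return_time N K X \<le> enat m" "X m \<notin> box_B_tilde N"
          unfolding k departure_time.simps first_time_from_le_iff by auto
        then have "m \<le> n" using T by (metis le_Suc_eq)
        then have "departure_time N K X \<le> enat n"
          unfolding k departure_time.simps first_time_from_le_iff using m k by auto
        then show False using IH by simp
      qed
      ultimately show ?thesis using IH early by (simp add: not_le)
    next
      case F: False
      then have st: "s X (Suc n) = (K, False)"
        using True by (simp add: s_def K_def cycle_step_def)
      have D: "departure_time N K X \<le> enat (Suc n)"
        unfolding k departure_time.simps first_time_from_le_iff
        using F IH(1) k early by auto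
      moreover have "\<not> return_time N (Suc K) X \<le> enat (Suc n)"
      proof
        assume "return_time N (Suc K) X \<le> enat (Suc n)"
        then obtain m where m: "m \<le> Suc n" "departure_time N K X \<le> enat m" "X m \<in> box_B N"
          unfolding return_time.simps first_time_from_le_iff by auto
        \<comment> \<open>The departure happens exactly now, so a return by this time would have to
          take place at a point outside the larger box.\<close>
        have "departure_time N K X = enat (Suc n)"
          using later[of "departure_time N K X"] D IH by (auto simp: not_le)
        then have "m = Suc n" using m by simp
        then show False using m F box_B_subset by blast
      qed
      ultimately show ?thesis using st by (simp add: not_le)
    qed
  next
    case False
    then have IH: "departure_time N K X \<le> enat n" "enat n < return_time N (Suc K) X"
      using Suc by (auto simp: K_def)
    show ?thesis
    proof (cases "X (Suc n) \<in> box_B N")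
      case T: True
      then have st: "s X (Suc n) = (Suc K, True)"
        using False by (simp add: s_def K_def cycle_step_def)
      have R: "return_time N (Suc K) X \<le> enat (Suc n)"
        unfolding return_time.simps first_time_from_le_iff
        using T IH(1) early by blast
      then have R': "return_time N (Suc K) X = enat (Suc n)"
        using IH later by (auto simp: not_le)
      have "\<not> departure_time N (Suc K) X \<le> enat (Suc n)"
      proof
        assume "departure_time N (Suc K) X \<le> enat (Suc n)"
        then obtain m where m: "m \<le> Suc n" "return_time N (Suc K) X \<le> enat m" "X m \<notin> box_B_tilde N"
          unfolding departure_time.simps first_time_from_le_iff by auto
        then have "m = Suc n" using R' by simp
        then show False using m T box_B_subset by blast
      qed
      then show ?thesis using st R by (simp add: not_le del: return_time.simps departure_time.simps)
    next
      case F: False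
      then have st: "s X (Suc n) = (K, False)"
        using False by (simp add: s_def K_def cycle_step_def)
      have "\<not> return_time N (Suc K) X \<le> enat (Suc n)"
      proof
        assume "return_time N (Suc K) X \<le> enat (Suc n)"
        then obtain m where m: "m \<le> Suc n" "departure_time N K X \<le> enat m" "X m \<in> box_B N"
          unfolding return_time.simps first_time_from_le_iff by auto
        then have "m \<le> n" using F by (metis le_Suc_eq)
        then have "return_time N (Suc K) X \<le> enat n"
          unfolding return_time.simps first_time_from_le_iff using m by blast
        then show False using IH by simp
      qed
      then show ?thesis using st IH early by (simp add: not_le del: return_time.simps)
    qed
  qed
qed

text \<open>In either phase n lies between the K-th return (inclusive) and the next one (exclusive),
  and return times are monotone in the index.\<close>

lemma return_time_le_iff:
  "return_time N k X \<le> enat n \<longleftrightarrow> k \<le> fst (cycle_state N (0, False) X n)"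
proof -
  define K where "K = fst (cycle_state N (0, False) X n)"
  have 1: "return_time N K X \<le> enat n" and 2: "enat n < return_time N (Suc K) X"
    using cycle_state_0_bounds[of N X n] return_departure_mono[of N K X]
    by (auto simp: K_def simp del: return_time.simps split: if_splits intro: order_trans less_le_trans)
  show ?thesis
  proof
    assume "return_time N k X \<le> enat n"
    then have "return_time N k X < return_time N (Suc K) X"
      using 2 by simp
    then have "\<not> Suc K \<le> k"
      using mono_return_time[of "Suc K" k N X] by (meson not_less)
    then show "k \<le> fst (cycle_state N (0, False) X n)" by (simp add: K_def)
  next
    assume "k \<le> fst (cycle_state N (0, False) X n)"
    then show "return_time N k X \<le> enat n"
      using mono_return_time[of k K N X] 1 by (simp add: K_def)
  qed
qed

section \<open>Supermartingale bounds and the walk killed at the origin\<close>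

lemma measurable_path_component:
  "(\<lambda>X. X n) \<in> (path_space :: (nat \<Rightarrow> int ^ 'd::finite) measure) \<rightarrow>\<^sub>M count_space UNIV"
  by (rule measurable_component_singleton) simp

lemma measurable_cycle_state:
  "(\<lambda>X. cycle_state N s X n) \<in> (path_space :: (nat \<Rightarrow> int ^ 'd::finite) measure) \<rightarrow>\<^sub>M count_space UNIV"
proof (induction n)
  case 0
  show ?case by (auto intro: measurable_compose[OF measurable_path_component])
next
  case (Suc n)
  show ?case unfolding cycle_state.simps
    by (rule measurable_compose_countable[OF _ Suc])
       (auto intro: measurable_compose[OF measurable_path_component])
qed

lemma measurable_cycle_functional:
  "(\<lambda>X. ennreal (V (cycle_state N s X n) (X n))) \<in> borel_measurable (path_space :: (nat \<Rightarrow> int ^ 'd::finite) measure)"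
  by (rule measurable_compose_countable[OF _ measurable_cycle_state])
     (auto intro: measurable_compose[OF measurable_path_component])

lemma sum_ennreal_avg:
  fixes f :: "int ^ 'd::finite \<Rightarrow> real"
  assumes "\<And>y. f y \<ge> 0"
  shows "(\<Sum>e\<in>unit_steps. ennreal (f (x + e))) * ennreal (1 / real (card (unit_steps :: (int ^ 'd) set)))
    = ennreal (avg f x)"
  using assms
  by (simp add: avg_unit_steps sum_nonneg ennreal_mult[symmetric])

lemma avg_const [simp]: "avg (\<lambda>_. c) (x :: int ^ 'd::finite) = c"
  by (simp add: avg_def)

lemma nn_integral_walk_from_0:
  fixes x :: "int ^ 'd::finite"
  assumes "\<And>y. f y \<ge> 0"
  shows "(\<integral>\<^sup>+X. ennreal (f (X 0)) \<partial>walk_from N x) = ennreal (f (torus_proj N x))"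
proof -
  have [measurable]: "(\<lambda>X. ennreal (f (X 0))) \<in> borel_measurable (path_space :: (nat \<Rightarrow> int ^ 'd) measure)"
    by (auto intro: measurable_compose[OF measurable_path_component])
  show ?thesis
    using sum_ennreal_avg[of "\<lambda>_. f (torus_proj N x)" x] assms
    by (subst nn_integral_walk_from_Suc)
       (auto simp: prob_space.emeasure_space_1[OF prob_space_walk_from])
qed

text \<open>Induction along the first step rather than the last, hence over all \<open>s\<close> and
  \<open>x\<close>. The hypothesis \<open>super\<close> is asked only for positions compatible with
  the phase: by \<open>snd_cycle_step\<close> the state reached after reading a position is always
  compatible with it.\<close>

lemma nn_integral_cycle_le:
  fixes x :: "int ^ 'd::finite"
  assumes nonneg: "\<And>s y. V s y \<ge> 0" and "r \<ge> 0"
    and per: "\<And>s y. V s (torus_proj N y) = V s y"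
    and super: "\<And>s y. (if snd s then torus_proj N y \<in> box_B_tilde N else torus_proj N y \<notin> box_B N) \<Longrightarrow>
        avg (\<lambda>z. V (cycle_step N s (torus_proj N z)) z) y \<le> r * V s y"
  shows "(\<integral>\<^sup>+X. ennreal (V (cycle_state N s X n) (X n)) \<partial>walk_from N x)
    \<le> ennreal (r ^ n * V (cycle_step N s (torus_proj N x)) x)"
proof (induction n arbitrary: s x)
  case 0
  show ?case
    using nn_integral_walk_from_0[of "\<lambda>y. V (cycle_step N s y) y"] nonneg per by simp
next
  case (Suc n)
  let ?s = "cycle_step N s (torus_proj N x)"
  let ?c = "ennreal (1 / real (card (unit_steps :: (int ^ 'd) set)))"
  have "(\<integral>\<^sup>+X. ennreal (V (cycle_state N s X (Suc n)) (X (Suc n))) \<partial>walk_from N x) =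
      (\<Sum>e\<in>unit_steps. \<integral>\<^sup>+X. ennreal (V (cycle_state N ?s X n) (X n)) \<partial>walk_from N (x + e)) * ?c"
    by (subst nn_integral_walk_from_Suc[OF measurable_cycle_functional])
       (simp only: cycle_state_case_nat nat.case)
  also have "\<dots> \<le> (\<Sum>e\<in>unit_steps. ennreal (r ^ n * V (cycle_step N ?s (torus_proj N (x + e))) (x + e))) * ?c"
    by (intro mult_right_mono sum_mono Suc) simp
  also have "\<dots> = ennreal (avg (\<lambda>z. r ^ n * V (cycle_step N ?s (torus_proj N z)) z) x)"
    using nonneg \<open>r \<ge> 0\<close> by (intro sum_ennreal_avg) simp
  also have "avg (\<lambda>z. r ^ n * V (cycle_step N ?s (torus_proj N z)) z) x
      = r ^ n * avg (\<lambda>z. V (cycle_step N ?s (torus_proj N z)) z) x"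
    by (simp add: avg_unit_steps sum_distrib_left)
  also have "\<dots> \<le> r ^ n * (r * V ?s x)"
    using snd_cycle_step[of N s "torus_proj N x"] \<open>r \<ge> 0\<close>
    by (intro mult_left_mono super) auto
  finally show ?case by (simp add: ac_simps ennreal_leI)
qed

text \<open>Markov's inequality for \<open>V\<close>, averaged over the uniform start; the bound
  \<open>C\<close> covers the state after the starting point has been read.\<close>

lemma measure_cycle_state_le:
  assumes "N \<ge> 1" and nonneg: "\<And>s (y :: int ^ 'd::finite). V s y \<ge> 0" and "r \<ge> 0"
    and per: "\<And>s y. V s (torus_proj N y) = V s y"
    and super: "\<And>s y. (if snd s then torus_proj N y \<in> box_B_tilde N else torus_proj N y \<notin> box_B N) \<Longrightarrow>
        avg (\<lambda>z. V (cycle_step N s (torus_proj N z)) z) y \<le> r * V s y"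
    and init: "\<And>y. V (cycle_step N (0, False) (torus_proj N y)) y \<le> C"
    and low: "\<And>s y. s \<in> S \<Longrightarrow> \<alpha> \<le> V s y" and "\<alpha> > 0"
  shows "measure (torus_walk N :: (nat \<Rightarrow> int ^ 'd) measure) {X. cycle_state N (0, False) X n \<in> S} \<le> r ^ n * C / \<alpha>"
proof -
  let ?M = "torus_walk N :: (nat \<Rightarrow> int ^ 'd) measure"
  let ?A = "{X. cycle_state N (0, False) X n \<in> S} :: (nat \<Rightarrow> int ^ 'd) set"
  interpret prob_space ?M by (rule prob_space_torus_walk) fact
  have C: "C \<ge> 0" using init[of 0] nonneg order_trans by blast
  have A: "?A \<in> sets ?M"
    using measurable_sets[OF measurable_cycle_state[of N "(0, False)" n], of S]
    by (simp add: vimage_def space_PiM)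
  have "ennreal \<alpha> * emeasure ?M ?A = (\<integral>\<^sup>+X. ennreal \<alpha> * indicator ?A X \<partial>?M)"
    using A by (simp add: nn_integral_cmult_indicator)
  also have "\<dots> \<le> (\<integral>\<^sup>+X. ennreal (V (cycle_state N (0, False) X n) (X n)) \<partial>?M)"
    using low by (intro nn_integral_mono) (auto simp: indicator_def ennreal_leI)
  also have "\<dots> = (\<Sum>x\<in>torus N. \<integral>\<^sup>+X. ennreal (V (cycle_state N (0, False) X n) (X n)) \<partial>walk_from N x)
      * ennreal (1 / real N ^ CARD('d))"
    by (rule nn_integral_torus_walk[OF \<open>N \<ge> 1\<close> measurable_cycle_functional])
  also have "\<dots> \<le> (\<Sum>x\<in>(torus N :: (int ^ 'd) set). ennreal (r ^ n * C)) * ennreal (1 / real N ^ CARD('d))"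
  proof (intro mult_right_mono sum_mono)
    fix x :: "int ^ 'd"
    have "(\<integral>\<^sup>+X. ennreal (V (cycle_state N (0, False) X n) (X n)) \<partial>walk_from N x)
        \<le> ennreal (r ^ n * V (cycle_step N (0, False) (torus_proj N x)) x)"
      by (rule nn_integral_cycle_le[OF nonneg \<open>r \<ge> 0\<close> per super])
    also have "\<dots> \<le> ennreal (r ^ n * C)"
      using init \<open>r \<ge> 0\<close> by (intro ennreal_leI mult_left_mono) auto
    finally show "(\<integral>\<^sup>+X. ennreal (V (cycle_state N (0, False) X n) (X n)) \<partial>walk_from N x) \<le> ennreal (r ^ n * C)" .
  qed simp
  also have "\<dots> = ennreal (r ^ n * C)"
    using \<open>N \<ge> 1\<close> C \<open>r \<ge> 0\<close>
    by (simp add: card_torus ennreal_of_nat_eq_real_of_nat ennreal_mult[symmetric])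
  finally have "ennreal (\<alpha> * measure ?M ?A) \<le> ennreal (r ^ n * C)"
    using \<open>\<alpha> > 0\<close> by (simp add: emeasure_eq_measure ennreal_mult)
  then have "\<alpha> * measure ?M ?A \<le> r ^ n * C"
    using C \<open>r \<ge> 0\<close> by (simp add: ennreal_le_iff)
  then show ?thesis using \<open>\<alpha> > 0\<close> by (simp add: field_simps)
qed

text \<open>The probability that the walk from \<open>x\<close> stays off 0 through time n, as
  iterates of the kernel killed at 0. The recursion keeps the later analysis on finite sums;
  \<open>emeasure_walk_from_avoid\<close> is the link to path space.\<close>

primrec avoid :: "nat \<Rightarrow> nat \<Rightarrow> int ^ 'd::finite \<Rightarrow> real" where
  "avoid N 0 x = (if torus_proj N x = 0 then 0 else 1)"
| "avoid N (Suc n) x = (if torus_proj N x = 0 then 0 else avg (avoid N n) x)"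

lemma avoid_nonneg: "avoid N n x \<ge> 0"
  by (induction n arbitrary: x) (auto simp: avg_def intro!: sum_nonneg add_nonneg_nonneg divide_nonneg_nonneg)

lemma sets_avoid:
  "{X. \<forall>k\<le>n. X k \<noteq> 0} \<in> sets (path_space :: (nat \<Rightarrow> int ^ 'd::finite) measure)"
proof -
  have eq: "{X. \<forall>k\<le>n. X k \<noteq> 0} = (\<Inter>k\<in>{..n}. (\<lambda>X. X k) -` (- {0}) \<inter> space (path_space :: (nat \<Rightarrow> int ^ 'd) measure))"
    by (auto simp: space_PiM)
  show ?thesis unfolding eq
    by (intro sets.finite_INT measurable_sets[OF measurable_path_component]) auto
qed

lemma emeasure_walk_from_avoid:
  fixes x :: "int ^ 'd::finite"
  shows "emeasure (walk_from N x) {X. \<forall>k\<le>n. X k \<noteq> 0} = ennreal (avoid N n x)"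
proof (induction n arbitrary: x)
  case 0
  have "emeasure (walk_from N x) {X. \<forall>k\<le>0. X k \<noteq> 0}
      = (\<integral>\<^sup>+X. indicator {X. \<forall>k\<le>0. X k \<noteq> 0} X \<partial>walk_from N x)"
    by (rule nn_integral_indicator[symmetric]) (simp only: sets_walk_from sets_torus_walk sets_avoid)
  also have "\<dots> = (\<integral>\<^sup>+X. ennreal (if X 0 = 0 then 0 else 1) \<partial>walk_from N x)"
    by (intro nn_integral_cong) (auto simp: indicator_def)
  also have "\<dots> = ennreal (if torus_proj N x = 0 then 0 else 1)"
    by (rule nn_integral_walk_from_0) simp
  finally show ?case by simp
next
  case (Suc n)
  let ?A = "\<lambda>n. {X. \<forall>k\<le>n. X k \<noteq> 0} :: (nat \<Rightarrow> int ^ 'd) set"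
  have ind: "indicator (?A (Suc n)) (case_nat y X) = (if y = 0 then 0 else indicator (?A n) X :: ennreal)" for y X
  proof -
    have "case_nat y X \<in> ?A (Suc n) \<longleftrightarrow> y \<noteq> 0 \<and> X \<in> ?A n"
    proof -
      have "case_nat y X \<in> ?A (Suc n) \<longleftrightarrow> (\<forall>k<Suc (Suc n). case_nat y X k \<noteq> 0)"
        by (simp add: less_Suc_eq_le)
      also have "\<dots> \<longleftrightarrow> y \<noteq> 0 \<and> (\<forall>k<Suc n. X k \<noteq> 0)"
        by (subst All_less_Suc2) simp
      finally show ?thesis by (simp add: less_Suc_eq_le)
    qed
    then show ?thesis by (auto simp: indicator_def)
  qed
  have "emeasure (walk_from N x) (?A (Suc n)) = (\<integral>\<^sup>+X. indicator (?A (Suc n)) X \<partial>walk_from N x)"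
    by (rule nn_integral_indicator[symmetric]) (simp only: sets_walk_from sets_torus_walk sets_avoid)
  also have "\<dots> = (\<Sum>e\<in>unit_steps. \<integral>\<^sup>+X. indicator (?A (Suc n)) (case_nat (torus_proj N x) X) \<partial>walk_from N (x + e))
      * ennreal (1 / real (card (unit_steps :: (int ^ 'd) set)))"
    by (intro nn_integral_walk_from_Suc borel_measurable_indicator sets_avoid)
  also have "\<dots> = ennreal (avoid N (Suc n) x)"
  proof (cases "torus_proj N x = 0")
    case True
    then show ?thesis unfolding ind by simp
  next
    case False
    have "(\<integral>\<^sup>+X. indicator (?A n) X \<partial>walk_from N y) = ennreal (avoid N n y)" for y
      by (subst nn_integral_indicator) (simp_all add: sets_avoid Suc)
    then show ?thesis unfolding ind
      using False sum_ennreal_avg[of "avoid N n" x] by (simp add: avoid_nonneg)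
  qed
  finally show ?case .
qed

lemma measure_torus_walk_avoid:
  assumes "N \<ge> 1"
  shows "measure (torus_walk N :: (nat \<Rightarrow> int ^ 'd::finite) measure) {X. \<forall>k\<le>n. X k \<noteq> 0}
    = (\<Sum>x\<in>torus N. avoid N n (x :: int ^ 'd)) / real N ^ CARD('d)"
proof -
  let ?M = "torus_walk N :: (nat \<Rightarrow> int ^ 'd) measure"
  let ?A = "{X. \<forall>k\<le>n. X k \<noteq> 0} :: (nat \<Rightarrow> int ^ 'd) set"
  have "emeasure ?M ?A = (\<integral>\<^sup>+X. indicator ?A X \<partial>?M)"
    by (rule nn_integral_indicator[symmetric]) (simp only: sets_walk_from sets_torus_walk sets_avoid)
  also have "\<dots> = (\<Sum>x\<in>torus N. \<integral>\<^sup>+X. indicator ?A X \<partial>walk_from N x) * ennreal (1 / real N ^ CARD('d))"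
    by (intro nn_integral_torus_walk[OF assms] borel_measurable_indicator sets_avoid)
  also have "\<dots> = (\<Sum>x\<in>torus N. ennreal (avoid N n (x :: int ^ 'd))) * ennreal (1 / real N ^ CARD('d))"
    by (subst nn_integral_indicator) (simp_all add: sets_avoid emeasure_walk_from_avoid)
  also have "\<dots> = ennreal ((\<Sum>x\<in>torus N. avoid N n (x :: int ^ 'd)) / real N ^ CARD('d))"
    by (simp add: avoid_nonneg sum_nonneg ennreal_mult[symmetric])
  finally show ?thesis
    by (simp add: measure_def avoid_nonneg sum_nonneg)
qed

section \<open>Many returns are unlikely\<close>

definition tcos :: "nat \<Rightarrow> int \<Rightarrow> real" where
  "tcos N k = cos (2 * pi * of_int k / of_nat N)"

lemma cos_add_2pi_int: "cos (x + 2 * pi * of_int k) = cos x"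
  by (simp add: cos_add)

lemma tcos_add_period: "N \<ge> 1 \<Longrightarrow> tcos N (k + int N * j) = tcos N k"
proof -
  assume "N \<ge> 1"
  then have "2 * pi * of_int (k + int N * j) / of_nat N = 2 * pi * of_int k / of_nat N + 2 * pi * of_int j"
    by (simp add: field_simps)
  then show ?thesis by (simp add: tcos_def cos_add_2pi_int)
qed

lemma tcos_cong:
  assumes "N \<ge> 1" "k mod int N = l mod int N"
  shows "tcos N k = tcos N l"
proof -
  have "tcos N k = tcos N (k mod int N)" for k
    using tcos_add_period[OF assms(1), of "k mod int N" "k div int N"] by simp
  then show ?thesis using assms by metis
qed

lemma tcos_torus_proj [simp]: "N \<ge> 1 \<Longrightarrow> tcos N (torus_proj N x $ i) = tcos N (x $ i)"
  by (rule tcos_cong) (auto simp: torus_proj_def)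

lemma tcos_le_1: "tcos N k \<le> 1" and tcos_ge_m1: "- 1 \<le> tcos N k"
  by (simp_all add: tcos_def)

lemma centered_residue:
  assumes "N \<ge> 1"
  obtains j where "j mod int N = k mod int N" "2 * \<bar>j\<bar> \<le> int N"
proof
  define j where "j = (k + int N div 2) mod int N - int N div 2"
  show "j mod int N = k mod int N" by (simp add: j_def mod_simps)
  have "0 \<le> (k + int N div 2) mod int N" "(k + int N div 2) mod int N < int N"
    using assms by auto
  moreover have "2 * (int N div 2) \<le> int N" "int N - 1 \<le> 2 * (int N div 2)"
    by presburger+
  moreover have "2 * \<bar>m - h\<bar> \<le> n" if "0 \<le> m" "m < n" "2 * h \<le> n" "n - 1 \<le> 2 * h" for m n h :: int
    using that by (cases "h \<le> m") simp_all
  ultimately show "2 * \<bar>j\<bar> \<le> int N" unfolding j_def by blast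
qed

text \<open>Every residue has a representative of absolute value at most N/2, and on that range the
  cosine decreases in the absolute value. Since \<open>a\<close> is at most 1/2, the points of the
  box are such representatives too.\<close>

lemma torus_proj_mem_box_iff:
  fixes x :: "int ^ 'd::finite"
  assumes "N \<ge> 1" "0 \<le> a" "a \<le> 1 / 2"
  shows "torus_proj N x \<in> torus_proj N ` {z. \<forall>i. real_of_int (z $ i) \<in> {- (a * real N)..a * real N}}
    \<longleftrightarrow> (\<forall>i. cos (2 * pi * a) \<le> tcos N (x $ i))"
proof -
  have N: "real N > 0" using assms by simp
  have key: "real_of_int j \<in> {- (a * real N)..a * real N} \<longleftrightarrow> cos (2 * pi * a) \<le> tcos N j"
    if "2 * \<bar>j\<bar> \<le> int N" for j
  proof -
    have j: "2 * real_of_int \<bar>j\<bar> \<le> real N"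
      using that by (metis of_int_le_iff of_int_mult of_int_numeral of_int_of_nat_eq)
    have le: "2 * pi * real_of_int \<bar>j\<bar> / real N \<le> pi"
      using j N pi_gt_zero by (simp add: field_simps)
    have "tcos N j = cos \<bar>2 * pi * real_of_int j / real N\<bar>"
      unfolding tcos_def by (simp only: cos_abs_real)
    also have "\<bar>2 * pi * real_of_int j / real N\<bar> = 2 * pi * real_of_int \<bar>j\<bar> / real N"
      by (simp add: abs_mult)
    finally have "tcos N j = cos (2 * pi * real_of_int \<bar>j\<bar> / real N)" .
    moreover have "cos (2 * pi * a) \<le> cos (2 * pi * real_of_int \<bar>j\<bar> / real N)
        \<longleftrightarrow> 2 * pi * real_of_int \<bar>j\<bar> / real N \<le> 2 * pi * a"
      using assms le N by (intro cos_mono_le_eq) auto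
    moreover have "2 * pi * real_of_int \<bar>j\<bar> / real N \<le> 2 * pi * a \<longleftrightarrow> real_of_int \<bar>j\<bar> \<le> a * real N"
      using N by (simp add: field_simps)
    ultimately show ?thesis by auto
  qed
  show ?thesis
  proof
    assume "torus_proj N x \<in> torus_proj N ` {z. \<forall>i. real_of_int (z $ i) \<in> {- (a * real N)..a * real N}}"
    then obtain z where z: "\<And>i. real_of_int (z $ i) \<in> {- (a * real N)..a * real N}"
      and eq: "torus_proj N x = torus_proj N z" by blast
    show "\<forall>i. cos (2 * pi * a) \<le> tcos N (x $ i)"
    proof
      fix i
      have "a * real N \<le> 1 / 2 * real N" using assms by (intro mult_right_mono) auto
      then have "2 * \<bar>real_of_int (z $ i)\<bar> \<le> real N" using z[of i] by auto
      then have "2 * \<bar>z $ i\<bar> \<le> int N" by linarith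
      moreover have "tcos N (x $ i) = tcos N (z $ i)"
        using eq assms(1) by (intro tcos_cong) (auto simp: torus_proj_eq_iff)
      ultimately show "cos (2 * pi * a) \<le> tcos N (x $ i)"
        using key z by metis
    qed
  next
    assume R: "\<forall>i. cos (2 * pi * a) \<le> tcos N (x $ i)"
    have "\<exists>j. j mod int N = x $ i mod int N \<and> 2 * \<bar>j\<bar> \<le> int N" for i
      using centered_residue[OF assms(1)] by metis
    then obtain z where z: "\<And>i. z i mod int N = x $ i mod int N" "\<And>i. 2 * \<bar>z i\<bar> \<le> int N" by metis
    have "real_of_int (z i) \<in> {- (a * real N)..a * real N}" for i
      using key[OF z(2)] R tcos_cong[OF assms(1) z(1)] by simp
    moreover have "torus_proj N x = torus_proj N (\<chi> i. z i)"
      by (simp add: torus_proj_eq_iff z)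
    ultimately show "torus_proj N x \<in> torus_proj N ` {z. \<forall>i. real_of_int (z $ i) \<in> {- (a * real N)..a * real N}}"
      by auto
  qed
qed

lemma mem_box_B_iff:
  "N \<ge> 1 \<Longrightarrow> torus_proj N (x :: int ^ 'd::finite) \<in> box_B N \<longleftrightarrow> (\<forall>i. sqrt 2 / 2 \<le> tcos N (x $ i))"
  using torus_proj_mem_box_iff[of N "1/8" x] by (simp add: box_B_def cos_45)

lemma mem_box_B_tilde_iff:
  "N \<ge> 1 \<Longrightarrow> torus_proj N (x :: int ^ 'd::finite) \<in> box_B_tilde N \<longleftrightarrow> (\<forall>i. 0 \<le> tcos N (x $ i))"
  using torus_proj_mem_box_iff[of N "1/4" x] by (simp add: box_B_tilde_def)

section \<open>Calculus of one-step averages and second differences\<close>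

lemma avg_mono: "(\<And>y. f y \<le> g y) \<Longrightarrow> avg f x \<le> avg g x"
  by (auto simp: avg_def intro!: divide_right_mono sum_mono add_mono)

lemma avg_cmult: "avg (\<lambda>y. c * f y) x = c * avg f x"
  by (simp add: avg_unit_steps sum_distrib_left)

lemma avg_add: "avg (\<lambda>y. f y + g y) x = avg f x + avg g x"
  by (simp add: avg_unit_steps sum.distrib add_divide_distrib)

lemma avg_diff: "avg (\<lambda>y. f y - g y) x = avg f x - avg g x"
  by (simp add: avg_unit_steps sum_subtractf diff_divide_distrib)

lemma avg_sum: "avg (\<lambda>y. \<Sum>a\<in>A. f a y) x = (\<Sum>a\<in>A. avg (f a) x)"
  by (simp add: avg_unit_steps sum_divide_distrib sum.swap[of _ A])

text \<open>A step changes one coordinate only, so the generator acts on a sum over coordinates as a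
  one-dimensional second difference.\<close>

lemma avg_coord_sum:
  fixes x :: "int ^ 'd::finite"
  shows "avg (\<lambda>y. \<Sum>j\<in>UNIV. \<phi> (y $ j)) x =
    (\<Sum>j\<in>UNIV. \<phi> (x $ j)) +
    (\<Sum>j\<in>UNIV. \<phi> (x $ j + 1) + \<phi> (x $ j - 1) - 2 * \<phi> (x $ j)) / (2 * real CARD('d))"
proof -
  define S where "S = (\<Sum>j\<in>UNIV. \<phi> (x $ j))"
  have shift: "(\<Sum>j\<in>UNIV. \<phi> ((x + axis i c) $ j)) = S + (\<phi> (x $ i + c) - \<phi> (x $ i))" for i c
  proof -
    have "(\<Sum>j\<in>UNIV. \<phi> ((x + axis i c) $ j)) - S = (\<Sum>j\<in>UNIV. \<phi> ((x + axis i c) $ j) - \<phi> (x $ j))"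
      by (simp add: S_def sum_subtractf)
    also have "\<dots> = (\<Sum>j\<in>UNIV. if j = i then \<phi> (x $ i + c) - \<phi> (x $ i) else 0)"
      by (intro sum.cong) (auto simp: axis_def)
    finally show ?thesis by simp
  qed
  have minus: "x - axis i 1 = x + axis i (- 1)" for i :: 'd
    by (simp add: vec_eq_iff axis_def)
  have "avg (\<lambda>y. \<Sum>j\<in>UNIV. \<phi> (y $ j)) x =
      (\<Sum>i\<in>UNIV. 2 * S + (\<phi> (x $ i + 1) + \<phi> (x $ i - 1) - 2 * \<phi> (x $ i))) / (2 * real CARD('d))"
    unfolding avg_def minus shift by (simp add: algebra_simps)
  also have "\<dots> = S + (\<Sum>j\<in>UNIV. \<phi> (x $ j + 1) + \<phi> (x $ j - 1) - 2 * \<phi> (x $ j)) / (2 * real CARD('d))"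
    by (simp add: sum.distrib add_divide_distrib)
  finally show ?thesis by (simp add: S_def)
qed

lemma one_minus_cos_le: "1 - cos x \<le> x\<^sup>2 / 2" for x :: real
proof -
  have "1 - cos x = 2 * (sin (x / 2))\<^sup>2"
    using cos_double_sin[of "x / 2"] by simp
  also have "\<dots> \<le> 2 * (x / 2)\<^sup>2"
    using abs_sin_x_le_abs_x[of "x / 2"] by (intro mult_left_mono) (simp_all only: abs_le_square_iff zero_le_numeral)
  finally show ?thesis by (simp add: power2_eq_square)
qed

lemma cosh_le_exp_square: "cosh z \<le> exp (z\<^sup>2)" for z :: real
proof -
  have *: "cosh z \<le> exp (z\<^sup>2)" if "z \<ge> 0" for z :: real
  proof (cases "z \<le> 1")
    case True
    have 1: "exp z \<le> 1 + z + z\<^sup>2" using exp_bound[of z] that True by simp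
    \<comment> \<open>The quadratic lower bound for exp z becomes an upper bound for exp (-z)
      because its product with 1 - z + z^2 is at least 1.\<close>
    have "1 + z + z\<^sup>2 / 2 \<le> exp z" using exp_lower_Taylor_quadratic[of z] that by simp
    moreover have "1 - z + z\<^sup>2 \<ge> 0"
      using sum_squares_ge_zero[of "z - 1/2" 0] by (simp add: power2_eq_square algebra_simps)
    ultimately have "(1 + z + z\<^sup>2 / 2) * (1 - z + z\<^sup>2) \<le> exp z * (1 - z + z\<^sup>2)"
      by (rule mult_right_mono)
    moreover have "(1 + z + z\<^sup>2 / 2) * (1 - z + z\<^sup>2) = 1 + z^2/2 + z^3/2 + z^4/2"
      by (simp add: field_simps power2_eq_square power3_eq_cube power4_eq_xxxx)
    moreover have "z^2/2 + z^3/2 + z^4/2 \<ge> 0" using that by simp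
    ultimately have "1 \<le> exp z * (1 - z + z\<^sup>2)" by linarith
    then have 2: "exp (- z) \<le> 1 - z + z\<^sup>2" by (simp add: exp_minus field_simps)
    have "cosh z \<le> 1 + z\<^sup>2" using 1 2 by (simp add: cosh_field_def)
    also have "\<dots> \<le> exp (z\<^sup>2)" by (rule exp_ge_add_one_self)
    finally show ?thesis .
  next
    case False
    then have "cosh z \<le> exp z" by (simp add: cosh_field_def)
    also have "exp z \<le> exp (z\<^sup>2)" using False by (simp add: power2_eq_square)
    finally show ?thesis .
  qed
  show ?thesis using *[of z] *[of "- z"] by (cases "z \<ge> 0") auto
qed

text \<open>By the addition formulas the left side is
  \<open>exp (- l * cos t * cos \<delta>)\<close> times
  \<open>2 * cosh (l * (sin t * sin \<delta>))\<close>. The first factor differs from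
  \<open>exp (- l * cos t)\<close>, and the hyperbolic cosine from 1, by exponentials of order
  \<open>\<delta>\<^sup>2\<close>.\<close>

lemma exp_cos_second_difference:
  fixes l t \<delta> :: real
  assumes "l \<ge> 0"
  shows "exp (- l * cos (t + \<delta>)) + exp (- l * cos (t - \<delta>))
    \<le> 2 * exp ((l + l\<^sup>2) * \<delta>\<^sup>2) * exp (- l * cos t)"
proof -
  let ?z = "l * (sin t * sin \<delta>)"
  have "exp (- l * cos (t + \<delta>)) + exp (- l * cos (t - \<delta>)) =
      exp (- l * cos t * cos \<delta>) * (2 * cosh ?z)"
    by (simp add: cos_add cos_diff cosh_field_def exp_add[symmetric] algebra_simps)
  also have "\<dots> \<le> (exp (- l * cos t) * exp (l * \<delta>\<^sup>2)) * (2 * exp (l\<^sup>2 * \<delta>\<^sup>2))"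
  proof (intro mult_mono mult_left_mono)
    have "l * cos t * (1 - cos \<delta>) \<le> l * 1 * (\<delta>\<^sup>2 / 2)"
      using assms one_minus_cos_le[of \<delta>] by (intro mult_mono mult_left_mono) auto
    also have "\<dots> \<le> l * \<delta>\<^sup>2" using assms by (simp add: field_simps)
    finally have "- l * cos t * cos \<delta> \<le> - l * cos t + l * \<delta>\<^sup>2" by (simp add: algebra_simps)
    then show "exp (- l * cos t * cos \<delta>) \<le> exp (- l * cos t) * exp (l * \<delta>\<^sup>2)"
      by (simp add: exp_add[symmetric])
    have "\<bar>sin t * sin \<delta>\<bar> \<le> 1 * \<bar>\<delta>\<bar>"
      unfolding abs_mult by (intro mult_mono abs_sin_x_le_abs_x) auto
    then have "\<bar>?z\<bar> \<le> \<bar>l * \<delta>\<bar>" using assms by (simp add: abs_mult mult_left_mono)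
    then have "?z\<^sup>2 \<le> (l * \<delta>)\<^sup>2" by (simp only: abs_le_square_iff)
    then have "exp (?z\<^sup>2) \<le> exp (l\<^sup>2 * \<delta>\<^sup>2)" by (simp add: power_mult_distrib)
    then show "cosh ?z \<le> exp (l\<^sup>2 * \<delta>\<^sup>2)" using cosh_le_exp_square order_trans by blast
  qed auto
  also have "\<dots> = 2 * exp ((l + l\<^sup>2) * \<delta>\<^sup>2) * exp (- l * cos t)"
    by (simp add: exp_add[symmetric] algebra_simps)
  finally show ?thesis .
qed

text \<open>
  While the walk has to leave the larger box, \<open>\<Sum>i. exp (- l * cos (2\<pi>x\<^sub>i/N))\<close> is at most \<open>1/2\<close> at a
  return to \<open>B\<close> and at least \<open>1\<close> at the next departure, but its mean grows only by a factor
  \<open>exp (O(1/N\<^sup>2))\<close> in each step.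
\<close>

lemma prob_many_returns_le:
  "\<exists>a l :: real. a \<ge> 0 \<and> (\<forall>N n k. N \<ge> 1 \<longrightarrow>
    measure (torus_walk N :: (nat \<Rightarrow> int ^ 'd::finite) measure) {X. k \<le> fst (cycle_state N (0, False) X n)}
      \<le> exp (a * real n / (real N)\<^sup>2) * exp l / 2 ^ k)"
proof -
  define d where "d = real CARD('d)"
  have d: "d \<ge> 1" by (simp add: d_def Suc_leI)
  \<comment> \<open>In B every cosine is at least 1/2, so each summand is at most exp (-l/2) =
    1/(2d), and the sum over d coordinates is at most 1/2.\<close>
  define l where "l = 2 * ln (2 * d)"
  have l: "l \<ge> 0" using d by (simp add: l_def)
  define a where "a = (l + l\<^sup>2) * (2 * pi)\<^sup>2"
  have a: "a \<ge> 0" using l by (simp add: a_def)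
  have "measure (torus_walk N :: (nat \<Rightarrow> int ^ 'd) measure) {X. k \<le> fst (cycle_state N (0, False) X n)}
      \<le> exp (a * real n / (real N)\<^sup>2) * exp l / 2 ^ k" if N: "N \<ge> 1" for N n k
  proof -
    define r where "r = exp (a / (real N)\<^sup>2)"
    have r: "r \<ge> 1" using a by (simp add: r_def)
    define \<phi> where "\<phi> j = exp (- l * tcos N j)" for j
    define F where "F y = (\<Sum>i\<in>UNIV. \<phi> (y $ i))" for y :: "int ^ 'd"
    define V where "V s y = 2 ^ fst s * (if snd s then F y else 1)" for s :: "nat \<times> bool" and y
    have Fpos: "F y \<ge> 0" for y by (auto simp: F_def \<phi>_def intro: sum_nonneg)
    have diff: "\<phi> (j + 1) + \<phi> (j - 1) - 2 * \<phi> j \<le> 2 * (r - 1) * \<phi> j" for j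
    proof -
      have "(l + l\<^sup>2) * (2 * pi / real N)\<^sup>2 = a / (real N)\<^sup>2"
        by (simp add: a_def power_divide)
      then show ?thesis
        using exp_cos_second_difference[OF l, of "2 * pi * of_int j / of_nat N" "2 * pi / real N"]
        by (simp add: \<phi>_def tcos_def r_def add_divide_distrib diff_divide_distrib algebra_simps)
    qed
    have avgF: "avg F x \<le> r * F x" for x
    proof -
      have "avg F x = F x + (\<Sum>j\<in>UNIV. \<phi> (x $ j + 1) + \<phi> (x $ j - 1) - 2 * \<phi> (x $ j)) / (2 * d)"
        unfolding F_def d_def by (rule avg_coord_sum)
      also have "\<dots> \<le> F x + (\<Sum>j\<in>UNIV. 2 * (r - 1) * \<phi> (x $ j)) / (2 * d)"
        using d by (intro add_left_mono divide_right_mono sum_mono diff) auto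
      also have "\<dots> = F x + (r - 1) * F x / d"
        unfolding F_def sum_distrib_left[symmetric] using d by (simp add: field_simps)
      also have "\<dots> \<le> F x + (r - 1) * F x"
        using d r Fpos[of x] mult_left_mono[of 1 d "(r - 1) * F x"]
        by (intro add_left_mono) (simp add: pos_divide_le_eq)
      finally show ?thesis by (simp add: algebra_simps)
    qed
    have inB: "2 * F y \<le> 1" if "torus_proj N y \<in> box_B N" for y
    proof -
      have "\<phi> (y $ i) \<le> 1 / (2 * d)" for i
      proof -
        have "1 / 2 \<le> sqrt 2 / 2" by simp
        also have "\<dots> \<le> tcos N (y $ i)" using that N by (simp add: mem_box_B_iff)
        finally have "l * (1 / 2) \<le> l * tcos N (y $ i)" using l by (rule mult_left_mono)
        then have "\<phi> (y $ i) \<le> exp (- (l / 2))" by (simp add: \<phi>_def)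
        also have "\<dots> = 1 / (2 * d)" using d by (simp add: l_def exp_minus field_simps)
        finally show ?thesis .
      qed
      then have "F y \<le> (\<Sum>i\<in>(UNIV :: 'd set). 1 / (2 * d))" unfolding F_def by (intro sum_mono)
      also have "\<dots> = 1 / 2" using d by (simp add: d_def)
      finally show ?thesis by simp
    qed
    have outBt: "1 \<le> F y" if out: "torus_proj N y \<notin> box_B_tilde N" for y
    proof -
      obtain i where i: "tcos N (y $ i) < 0" using out N by (auto simp: mem_box_B_tilde_iff not_le)
      have "1 \<le> \<phi> (y $ i)" using i l by (simp add: \<phi>_def mult_nonneg_nonpos)
      also have "\<dots> \<le> F y" unfolding F_def by (rule member_le_sum) (auto simp: \<phi>_def)
      finally show ?thesis .
    qed
    have "measure (torus_walk N :: (nat \<Rightarrow> int ^ 'd) measure) {X. cycle_state N (0, False) X n \<in> {s. k \<le> fst s}}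
      \<le> r ^ n * 1 / (2 ^ k * exp (- l))"
    proof (rule measure_cycle_state_le[where V = V, OF N])
      show "V s y \<ge> 0" for s y using Fpos by (simp add: V_def)
      show "V s (torus_proj N y) = V s y" for s y using N by (simp add: V_def F_def \<phi>_def)
      show "avg (\<lambda>z. V (cycle_step N s (torus_proj N z)) z) y \<le> r * V s y" for s y
      proof (cases "snd s")
        case True
        \<comment> \<open>At a departure the factor \<open>F\<close> is replaced by 1, which is
          smaller.\<close>
        have "avg (\<lambda>z. V (cycle_step N s (torus_proj N z)) z) y \<le> avg (\<lambda>z. 2 ^ fst s * F z) y"
          using True outBt by (intro avg_mono) (auto simp: V_def cycle_step_def)
        also have "\<dots> \<le> r * V s y"
          using True avgF[of y] by (simp add: avg_cmult V_def mult.left_commute)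
        finally show ?thesis .
      next
        case False
        \<comment> \<open>At a return the doubling of \<open>2 ^ k\<close> is paid for by
          \<open>F\<close> being at most 1/2 on B.\<close>
        have "avg (\<lambda>z. V (cycle_step N s (torus_proj N z)) z) y \<le> avg (\<lambda>z. 2 ^ fst s) y"
          using False inB by (intro avg_mono) (auto simp: V_def cycle_step_def)
        also have "\<dots> \<le> r * V s y"
          using False r by (simp add: V_def)
        finally show ?thesis .
      qed
      show "V (cycle_step N (0, False) (torus_proj N y)) y \<le> 1" for y
        using inB by (auto simp: V_def cycle_step_def)
      show "2 ^ k * exp (- l) \<le> V s y" if "s \<in> {s. k \<le> fst s}" for s y
      proof -
        \<comment> \<open>Deep inside the box \<open>F\<close> is small, but never below exp (-l);
          this is the source of the prefactor exp l.\<close>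
        have 1: "exp (- l) \<le> F y"
        proof -
          fix i :: 'd
          have "l * tcos N (y $ i) \<le> l" using l tcos_le_1[of N] mult_left_le by blast
          then have "exp (- l) \<le> \<phi> (y $ i)" by (simp add: \<phi>_def)
          also have "\<dots> \<le> F y" unfolding F_def by (rule member_le_sum) (auto simp: \<phi>_def)
          finally show ?thesis .
        qed
        show ?thesis unfolding V_def using that l 1
          by (intro mult_mono) (auto intro: power_increasing)
      qed
    qed (use r in auto)
    also have "r ^ n = exp (a * real n / (real N)\<^sup>2)"
      by (simp add: r_def exp_of_nat_mult[symmetric] mult.commute)
    finally show ?thesis by (simp add: exp_minus field_simps)
  qed
  then show ?thesis using a by blast
qed

section \<open>Few returns are unlikely\<close>

text \<open>The sine is concave on [0, pi/2] and so lies above its chord; apply this to |y|/2 and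
  use the half-angle formula.\<close>

lemma one_minus_cos_ge:
  fixes y :: real
  assumes "\<bar>y\<bar> \<le> pi"
  shows "2 * y\<^sup>2 / pi\<^sup>2 \<le> 1 - cos y"
proof -
  have conc: "concave_on {0..pi / 2} sin"
    by (rule f''_le0_imp_concave[where f' = cos and f'' = "\<lambda>x. - sin x"])
       (auto intro!: derivative_eq_intros sin_ge_zero)
  define z where "z = \<bar>y\<bar> / pi"
  have z: "0 \<le> z" "z \<le> 1" using assms by (auto simp: z_def)
  have "(1 - z) * sin 0 + z * sin (pi / 2) \<le> sin ((1 - z) *\<^sub>R 0 + z *\<^sub>R (pi / 2))"
    by (rule concave_onD[OF conc]) (use z in auto)
  then have "z \<le> sin (\<bar>y\<bar> / 2)" by (simp add: z_def)
  then have "z\<^sup>2 \<le> (sin (\<bar>y\<bar> / 2))\<^sup>2" using z by (intro power_mono)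
  then have "2 * z\<^sup>2 \<le> 1 - cos \<bar>y\<bar>" using cos_double_sin[of "\<bar>y\<bar> / 2"] by simp
  then show ?thesis by (simp add: z_def power_divide)
qed

lemma one_minus_tcos_ge:
  assumes "N \<ge> 1" "2 * \<bar>j\<bar> \<le> int N"
  shows "8 * (real_of_int j)\<^sup>2 / (real N)\<^sup>2 \<le> 1 - tcos N j"
proof -
  have j: "2 * real_of_int \<bar>j\<bar> \<le> real N"
    using assms(2) by (metis of_int_le_iff of_int_mult of_int_numeral of_int_of_nat_eq)
  let ?y = "2 * pi * of_int j / of_nat N"
  have "\<bar>?y\<bar> \<le> pi" using j assms(1) by (simp add: abs_mult field_simps)
  then have "2 * ?y\<^sup>2 / pi\<^sup>2 \<le> 1 - tcos N j" unfolding tcos_def by (rule one_minus_cos_ge)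
  then show ?thesis by (simp add: power_mult_distrib power_divide)
qed

lemma one_minus_tcos_ge':
  assumes "N \<ge> 1" "j mod int N \<noteq> 0"
  shows "8 / (real N)\<^sup>2 \<le> 1 - tcos N j"
proof -
  obtain l where l: "l mod int N = j mod int N" "2 * \<bar>l\<bar> \<le> int N"
    using centered_residue[OF assms(1)] by metis
  have "l \<noteq> 0" using l assms by auto
  then have "1 \<le> \<bar>l\<bar>" by simp
  then have "1 \<le> \<bar>real_of_int l\<bar>" by linarith
  then have "1 \<le> (real_of_int l)\<^sup>2" using abs_le_square_iff[of 1 "real_of_int l"] by simp
  then have "8 / (real N)\<^sup>2 \<le> 8 * (real_of_int l)\<^sup>2 / (real N)\<^sup>2"
    by (intro divide_right_mono) auto
  also have "\<dots> \<le> 1 - tcos N l" by (rule one_minus_tcos_ge[OF assms(1) l(2)])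
  also have "tcos N l = tcos N j" by (rule tcos_cong[OF assms(1) l(1)])
  finally show ?thesis .
qed

text \<open>The real part of the torus character with frequency \<open>\<xi>\<close>.\<close>

definition wave :: "nat \<Rightarrow> int ^ 'd \<Rightarrow> int ^ 'd::finite \<Rightarrow> real" where
  "wave N \<xi> x = tcos N (\<Sum>i\<in>UNIV. \<xi> $ i * x $ i)"

text \<open>The eigenvalue of \<open>avg\<close> on that character.\<close>

definition symbol :: "nat \<Rightarrow> int ^ 'd::finite \<Rightarrow> real" where
  "symbol N \<xi> = (\<Sum>i\<in>UNIV. tcos N (\<xi> $ i)) / real CARD('d)"

lemma avg_wave: "avg (wave N \<xi>) x = symbol N \<xi> * wave N \<xi> x"
proof -
  have shift: "(\<Sum>j\<in>UNIV. \<xi> $ j * (x + axis i c) $ j) = (\<Sum>j\<in>UNIV. \<xi> $ j * x $ j) + \<xi> $ i * c" for i c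
  proof -
    have "(\<Sum>j\<in>UNIV. \<xi> $ j * (x + axis i c) $ j) = (\<Sum>j\<in>UNIV. \<xi> $ j * x $ j + (if j = i then \<xi> $ i * c else 0))"
      by (intro sum.cong) (auto simp: axis_def algebra_simps)
    then show ?thesis by (simp add: sum.distrib)
  qed
  have minus: "x - axis i 1 = x + axis i (- 1)" for i :: 'a
    by (simp add: vec_eq_iff axis_def)
  have "tcos N (a + b) + tcos N (a - b) = 2 * (tcos N b * tcos N a)" for a b
    by (simp add: tcos_def add_divide_distrib diff_divide_distrib distrib_left right_diff_distrib cos_add cos_diff)
  then have "avg (wave N \<xi>) x = (\<Sum>i\<in>UNIV. 2 * (tcos N (\<xi> $ i) * wave N \<xi> x)) / (2 * real CARD('a))"
    unfolding avg_def wave_def minus shift by simp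
  then show ?thesis
    by (simp add: symbol_def sum_distrib_left[symmetric] sum_distrib_right[symmetric])
qed

lemma wave_torus_proj:
  assumes "N \<ge> 1"
  shows "wave N \<xi> (torus_proj N x) = wave N \<xi> x"
  unfolding wave_def
proof (rule tcos_cong[OF assms])
  have "(\<Sum>i\<in>UNIV. \<xi> $ i * torus_proj N x $ i) mod int N
      = (\<Sum>i\<in>UNIV. (\<xi> $ i * torus_proj N x $ i) mod int N) mod int N"
    by (simp only: mod_sum_eq)
  also have "\<dots> = (\<Sum>i\<in>UNIV. (\<xi> $ i * x $ i) mod int N) mod int N"
    by (simp add: torus_proj_def mod_mult_right_eq)
  also have "\<dots> = (\<Sum>i\<in>UNIV. \<xi> $ i * x $ i) mod int N"
    by (simp only: mod_sum_eq)
  finally show "(\<Sum>i\<in>UNIV. \<xi> $ i * torus_proj N x $ i) mod int N = (\<Sum>i\<in>UNIV. \<xi> $ i * x $ i) mod int N" .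
qed

lemma wave_le_1: "wave N \<xi> x \<le> 1" and wave_ge_m1: "- 1 \<le> wave N \<xi> x"
  by (simp_all add: wave_def tcos_le_1 tcos_ge_m1)

lemma one_minus_symbol:
  "1 - symbol N (\<xi> :: int ^ 'd::finite) = (\<Sum>i\<in>UNIV. 1 - tcos N (\<xi> $ i)) / real CARD('d)"
  by (simp add: symbol_def sum_subtractf diff_divide_distrib)

lemma one_minus_symbol_ge:
  "(1 - tcos N (\<xi> $ i)) / real CARD('d) \<le> 1 - symbol N (\<xi> :: int ^ 'd::finite)"
  unfolding one_minus_symbol
  by (intro divide_right_mono member_le_sum[of i]) (auto simp: tcos_le_1)

lemma symbol_le_1: "symbol N \<xi> \<le> 1"
  using one_minus_symbol_ge[of N \<xi>] tcos_le_1[of N]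
  by (meson diff_ge_0_iff_ge divide_nonneg_nonneg of_nat_0_le_iff order_trans)

lemma symbol_eq_1D:
  assumes "N \<ge> 1" "symbol N (\<xi> :: int ^ 'd::finite) = 1"
  shows "\<xi> $ i mod int N = 0"
proof (rule ccontr)
  assume "\<xi> $ i mod int N \<noteq> 0"
  then have "8 / (real N)\<^sup>2 \<le> 1 - tcos N (\<xi> $ i)" by (rule one_minus_tcos_ge'[OF assms(1)])
  moreover have "0 < 8 / (real N)\<^sup>2" using assms(1) by simp
  ultimately have "0 < 1 - tcos N (\<xi> $ i)" by (rule less_le_trans[rotated])
  then have "0 < (1 - tcos N (\<xi> $ i)) / real CARD('d)" by simp
  then show False using one_minus_symbol_ge[of N \<xi> i] assms(2) by simp
qed

text \<open>A fixed window of frequencies can contain nonzero multiples of N when N is small, and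
  these alias to the constant mode. For this reason the modes are sorted below by
  \<open>symbol N \<xi> = 1\<close> and not by \<open>\<xi> = 0\<close>.\<close>

lemma wave_eq_1:
  assumes "N \<ge> 1" "symbol N \<xi> = 1"
  shows "wave N \<xi> x = 1"
proof -
  have "(\<Sum>i\<in>UNIV. \<xi> $ i * x $ i) mod int N = (\<Sum>i\<in>UNIV. (\<xi> $ i * x $ i) mod int N) mod int N"
    by (simp only: mod_sum_eq)
  also have "\<dots> = 0 mod int N"
  proof -
    have "(\<xi> $ i * x $ i) mod int N = 0" for i
      using mod_mult_left_eq[of "\<xi> $ i" "int N" "x $ i"] symbol_eq_1D[OF assms, of i] by simp
    then show ?thesis by simp
  qed
  finally have "wave N \<xi> x = tcos N 0" unfolding wave_def by (rule tcos_cong[OF assms(1)])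
  then show ?thesis by (simp add: tcos_def)
qed

text \<open>
  Dividing by \<open>1 - symbol N \<xi>\<close> inverts the generator \<open>f \<mapsto> f - avg f\<close> on the nontrivial Fourier
  modes; the constants \<open>1\<close> make the function nonnegative when all coefficients \<open>c \<xi>\<close> are.
\<close>

definition potential :: "nat \<Rightarrow> (int ^ 'd) set \<Rightarrow> (int ^ 'd \<Rightarrow> real) \<Rightarrow> int ^ 'd::finite \<Rightarrow> real" where
  "potential N \<Xi> c x = (\<Sum>\<xi>\<in>{\<xi>\<in>\<Xi>. symbol N \<xi> \<noteq> 1}. c \<xi> / (1 - symbol N \<xi>) * (1 - wave N \<xi> x))"

lemma potential_nonneg:
  assumes "\<And>\<xi>. c \<xi> \<ge> 0"
  shows "0 \<le> potential N \<Xi> c x"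
  unfolding potential_def using assms symbol_le_1
  by (intro sum_nonneg mult_nonneg_nonneg divide_nonneg_nonneg) (simp_all add: wave_le_1)

lemma potential_le:
  assumes "\<And>\<xi>. c \<xi> \<ge> 0"
  shows "potential N \<Xi> c x \<le> 2 * (\<Sum>\<xi>\<in>{\<xi>\<in>\<Xi>. symbol N \<xi> \<noteq> 1}. c \<xi> / (1 - symbol N \<xi>))"
proof -
  have "potential N \<Xi> c x \<le> (\<Sum>\<xi>\<in>{\<xi>\<in>\<Xi>. symbol N \<xi> \<noteq> 1}. c \<xi> / (1 - symbol N \<xi>) * 2)"
    unfolding potential_def
  proof (intro sum_mono mult_left_mono)
    fix \<xi>
    show "1 - wave N \<xi> x \<le> 2" using wave_ge_m1[of N \<xi> x] by simp
    show "0 \<le> c \<xi> / (1 - symbol N \<xi>)"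
      using assms symbol_le_1[of N \<xi>] by (intro divide_nonneg_nonneg) auto
  qed
  then show ?thesis by (simp add: sum_distrib_left mult.commute)
qed

lemma potential_torus_proj: "N \<ge> 1 \<Longrightarrow> potential N \<Xi> c (torus_proj N x) = potential N \<Xi> c x"
  by (simp add: potential_def wave_torus_proj)

text \<open>On a nontrivial mode the factor \<open>1 - symbol N \<xi>\<close> cancels. The other
  modes are constant, and the sum of their coefficients is the mean of the trigonometric polynomial.
  So the drift of the potential is the polynomial minus its mean: negative wherever the polynomial
  is below its mean.\<close>

lemma avg_potential:
  assumes N: "N \<ge> 1" and fin: "finite \<Xi>"
  shows "avg (potential N \<Xi> c) x =
    potential N \<Xi> c x - (\<Sum>\<xi>\<in>{\<xi>\<in>\<Xi>. symbol N \<xi> = 1}. c \<xi>) + (\<Sum>\<xi>\<in>\<Xi>. c \<xi> * wave N \<xi> x)"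
proof -
  define A where "A = {\<xi>\<in>\<Xi>. symbol N \<xi> \<noteq> 1}"
  define w where "w \<xi> = c \<xi> / (1 - symbol N \<xi>)" for \<xi>
  have pot: "potential N \<Xi> c = (\<lambda>x. \<Sum>\<xi>\<in>A. w \<xi> * (1 - wave N \<xi> x))"
    by (rule ext) (simp only: potential_def A_def w_def)
  have "avg (potential N \<Xi> c) x = (\<Sum>\<xi>\<in>A. w \<xi> * (1 - symbol N \<xi> * wave N \<xi> x))"
    unfolding pot by (simp only: avg_sum avg_cmult avg_diff avg_const avg_wave)
  then have "avg (potential N \<Xi> c) x - potential N \<Xi> c x
      = (\<Sum>\<xi>\<in>A. w \<xi> * (1 - symbol N \<xi>) * wave N \<xi> x)"
    by (simp add: pot sum_subtractf[symmetric] algebra_simps)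
  also have "\<dots> = (\<Sum>\<xi>\<in>A. c \<xi> * wave N \<xi> x)"
    by (intro sum.cong) (auto simp: A_def w_def)
  also have "\<dots> = (\<Sum>\<xi>\<in>\<Xi>. c \<xi> * wave N \<xi> x) - (\<Sum>\<xi>\<in>{\<xi>\<in>\<Xi>. symbol N \<xi> = 1}. c \<xi> * wave N \<xi> x)"
  proof -
    have "\<Xi> = A \<union> {\<xi>\<in>\<Xi>. symbol N \<xi> = 1}" "A \<inter> {\<xi>\<in>\<Xi>. symbol N \<xi> = 1} = {}"
      by (auto simp: A_def)
    then have "(\<Sum>\<xi>\<in>\<Xi>. c \<xi> * wave N \<xi> x) =
        (\<Sum>\<xi>\<in>A. c \<xi> * wave N \<xi> x) + (\<Sum>\<xi>\<in>{\<xi>\<in>\<Xi>. symbol N \<xi> = 1}. c \<xi> * wave N \<xi> x)"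
      using fin by (metis (no_types, lifting) finite_Un sum.union_disjoint)
    then show ?thesis by simp
  qed
  also have "(\<Sum>\<xi>\<in>{\<xi>\<in>\<Xi>. symbol N \<xi> = 1}. c \<xi> * wave N \<xi> x) = (\<Sum>\<xi>\<in>{\<xi>\<in>\<Xi>. symbol N \<xi> = 1}. c \<xi>)"
    by (intro sum.cong) (auto simp: wave_eq_1[OF N])
  finally show ?thesis by simp
qed

section \<open>Trigonometric polynomials as products over coordinates\<close>

lemma prod_cis: "finite A \<Longrightarrow> (\<Prod>i\<in>A. cis (t i)) = cis (\<Sum>i\<in>A. t i)"
  by (induction A rule: finite_induct) (simp_all add: cis_mult)

lemma bij_betw_vec_PiE:
  "bij_betw (\<lambda>\<xi> i. \<xi> $ i) {\<xi> :: 'a ^ 'd::finite. \<forall>i. \<xi> $ i \<in> J} (PiE UNIV (\<lambda>_. J))"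
  by (rule bij_betwI[where g = "\<lambda>f. \<chi> i. f i"]) (auto simp: PiE_UNIV_domain)

lemma sum_vec_prod:
  fixes f :: "'d::finite \<Rightarrow> 'a \<Rightarrow> 'b::comm_semiring_1"
  assumes "finite J"
  shows "(\<Sum>\<xi>\<in>{\<xi> :: 'a ^ 'd::finite. \<forall>i. \<xi> $ i \<in> J}. \<Prod>i\<in>UNIV. f i (\<xi> $ i)) = (\<Prod>i\<in>UNIV. \<Sum>j\<in>J. f i j)"
proof -
  have "(\<Prod>i\<in>UNIV. \<Sum>j\<in>J. f i j) = (\<Sum>g\<in>PiE UNIV (\<lambda>_. J). \<Prod>i\<in>UNIV. f i (g i))"
    by (rule prod_sum_PiE) (auto simp: assms)
  also have "\<dots> = (\<Sum>\<xi>\<in>{\<xi> :: 'a ^ 'd::finite. \<forall>i. \<xi> $ i \<in> J}. \<Prod>i\<in>UNIV. f i (\<xi> $ i))"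
    by (rule sum.reindex_bij_betw[OF bij_betw_vec_PiE, symmetric])
  finally show ?thesis by simp
qed

lemma finite_vec_set:
  "finite J \<Longrightarrow> finite {\<xi> :: 'a ^ 'd::finite. \<forall>i. \<xi> $ i \<in> J}"
  using bij_betw_finite[OF bij_betw_vec_PiE[where J = J and 'd = 'd]] finite_PiE[of "UNIV :: 'd set" "\<lambda>_. J"]
  by simp

text \<open>Complex exponentials are used because, unlike cosines of a sum, they factor over the
  coordinates.\<close>

lemma sum_wave_prod:
  fixes x :: "int ^ 'd::finite" and w :: "int \<Rightarrow> real"
  assumes "finite J"
  shows "(\<Sum>\<xi>\<in>{\<xi> :: int ^ 'd. \<forall>i. \<xi> $ i \<in> J}. (\<Prod>i\<in>UNIV. w (\<xi> $ i)) * wave N \<xi> x)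
    = Re (\<Prod>i\<in>UNIV. \<Sum>j\<in>J. of_real (w j) * cis (of_int j * (2 * pi * of_int (x $ i) / of_nat N)))"
proof -
  let ?t = "\<lambda>i j. of_int j * (2 * pi * of_int (x $ i) / of_nat N)"
  have "(\<Prod>i\<in>UNIV. \<Sum>j\<in>J. of_real (w j) * cis (?t i j))
      = (\<Sum>\<xi>\<in>{\<xi> :: int ^ 'd. \<forall>i. \<xi> $ i \<in> J}. \<Prod>i\<in>UNIV. of_real (w (\<xi> $ i)) * cis (?t i (\<xi> $ i)))"
    by (rule sum_vec_prod[OF assms, symmetric])
  also have "\<dots> = (\<Sum>\<xi>\<in>{\<xi> :: int ^ 'd. \<forall>i. \<xi> $ i \<in> J}.
      of_real (\<Prod>i\<in>UNIV. w (\<xi> $ i)) * cis (\<Sum>i\<in>UNIV. ?t i (\<xi> $ i)))"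
    by (simp add: prod.distrib prod_cis)
  finally have "Re (\<Prod>i\<in>UNIV. \<Sum>j\<in>J. of_real (w j) * cis (?t i j))
      = (\<Sum>\<xi>\<in>{\<xi> :: int ^ 'd. \<forall>i. \<xi> $ i \<in> J}. (\<Prod>i\<in>UNIV. w (\<xi> $ i)) * cos (\<Sum>i\<in>UNIV. ?t i (\<xi> $ i)))"
    by (simp del: of_real_prod)
  also have "(\<lambda>\<xi> :: int ^ 'd. cos (\<Sum>i\<in>UNIV. ?t i (\<xi> $ i))) = (\<lambda>\<xi>. wave N \<xi> x)"
    by (simp add: wave_def tcos_def sum_divide_distrib sum_distrib_left mult_ac)
  finally show ?thesis by simp
qed

text \<open>Since (1 + e^(it))^2 = e^(it) (2 + 2 cos t), the right side is the binomial expansion of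
  (1 + e^(it))^(2m), recentred by e^(-imt). This exhibits the Fourier coefficients as binomial,
  hence nonnegative.\<close>

lemma sum_binomial_cis:
  "(\<Sum>j\<in>{- int m..int m}. of_real (real ((2 * m) choose nat (int m + j))) * cis (of_int j * t))
    = of_real ((2 + 2 * cos t) ^ m)"
proof -
  have "(1 + cis t) ^ 2 = cis t * of_real (2 + 2 * cos t)"
  proof -
    have "cis t * cis (- t) = 1" by (simp add: cis_mult)
    moreover have "of_real (2 + 2 * cos t) = 2 + cis t + cis (- t)"
      by (simp add: complex_eq_iff)
    ultimately show ?thesis by (simp add: power2_eq_square algebra_simps)
  qed
  then have "(1 + cis t) ^ (2 * m) = cis t ^ m * of_real ((2 + 2 * cos t) ^ m)"
    by (simp only: power_mult power_mult_distrib of_real_power)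
  then have "(1 + cis t) ^ (2 * m) = cis (of_nat m * t) * of_real ((2 + 2 * cos t) ^ m)"
    by (simp only: Complex.DeMoivre)
  then have "of_real ((2 + 2 * cos t) ^ m) = cis (- (of_nat m * t)) * (1 + cis t) ^ (2 * m)"
    by (simp add: mult.assoc[symmetric] cis_mult)
  also have "\<dots> = (\<Sum>k\<le>2 * m. of_nat ((2 * m) choose k) * cis ((of_nat k - of_nat m) * t))"
  proof -
    have "cis (- (of_nat m * t)) * cis t ^ k = cis ((of_nat k - of_nat m) * t)" for k
      by (simp add: Complex.DeMoivre cis_mult algebra_simps)
    then have "cis (- (of_nat m * t)) * (z * cis t ^ k) = z * cis ((of_nat k - of_nat m) * t)" for z k
      by (subst mult.left_commute) simp
    then show ?thesis
      by (subst add.commute, subst binomial_ring) (simp only: sum_distrib_left power_one mult_1_right)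
  qed
  also have "\<dots> = (\<Sum>j\<in>{- int m..int m}. of_real (real ((2 * m) choose nat (int m + j))) * cis (of_int j * t))"
    by (rule sum.reindex_bij_witness[where i = "\<lambda>j. nat (int m + j)" and j = "\<lambda>k. int k - int m"]) auto
  finally show ?thesis by simp
qed

text \<open>7/8 compares the factor 7/2, which bounds 2 + 2 cos at a coordinate outside B, with the
  maximum 4. The power of 2m is the loss in bounding d central binomial coefficients from below by
  4^m/(2m).\<close>

lemma exists_binomial_decay: "\<exists>m\<ge>1. (2 * real m) ^ d * (7 / 8) ^ m \<le> 1 / 2"
proof -
  have "(\<lambda>m::nat. (2 * real m) ^ d * (7 / 8 :: real) ^ m) \<longlonglongrightarrow> 0"
    by real_asymp
  then have "eventually (\<lambda>m::nat. (2 * real m) ^ d * (7 / 8 :: real) ^ m < 1 / 2) sequentially"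
    by (rule order_tendstoD) simp
  then have "eventually (\<lambda>m::nat. (2 * real m) ^ d * (7 / 8 :: real) ^ m < 1 / 2 \<and> m \<ge> 1) sequentially"
    using eventually_ge_at_top[of 1] by eventually_elim simp
  then show ?thesis
    by (auto simp: eventually_sequentially intro: less_imp_le)
qed

text \<open>
  The trigonometric polynomial \<open>\<Prod>i. (2 + 2 * cos (2\<pi>x\<^sub>i/N)) ^ m\<close> has nonnegative Fourier
  coefficients and, for \<open>m\<close> large, off \<open>B\<close> it is smaller than half of its mean.
\<close>

lemma superharmonic_off_box_B:
  "\<exists>\<beta> M :: real. \<beta> > 0 \<and> M \<ge> 0 \<and> (\<forall>N\<ge>1. \<exists>H :: int ^ 'd::finite \<Rightarrow> real.
    (\<forall>x. 0 \<le> H x \<and> H x \<le> M \<and> H (torus_proj N x) = H x) \<and>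
    (\<forall>x. torus_proj N x \<notin> box_B N \<longrightarrow> avg H x \<le> H x - \<beta> / (real N)\<^sup>2))"
proof -
  define d where "d = CARD('d)"
  have d: "d \<ge> 1" by (simp add: d_def Suc_leI)
  obtain m where m: "m \<ge> 1" "(2 * real m) ^ d * (7 / 8) ^ m \<le> 1 / 2"
    using exists_binomial_decay by blast
  define w where "w j = real ((2 * m) choose nat (int m + j))" for j
  define J where "J = {- int m..int m}"
  define \<Xi> where "\<Xi> = {\<xi> :: int ^ 'd. \<forall>i. \<xi> $ i \<in> J}"
  define c where "c \<xi> = (\<Prod>i\<in>UNIV. w (\<xi> $ i))" for \<xi> :: "int ^ 'd"
  have J: "finite J" by (simp add: J_def)
  have \<Xi>: "finite \<Xi>" unfolding \<Xi>_def by (rule finite_vec_set[OF J])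
  have c: "c \<xi> \<ge> 0" for \<xi> unfolding c_def w_def by (intro prod_nonneg) auto
  \<comment> \<open>The constant Fourier coefficient is at least \<open>2 * \<beta>\<close>, while
    off B the polynomial will be at most \<open>\<beta>\<close>.\<close>
  define \<beta> where "\<beta> = (4 ^ m / (2 * real m)) ^ d / 2"
  \<comment> \<open>Nontrivial modes have \<open>1 - symbol N \<xi>\<close> at least 8/(d N^2), so
    the potential is at most d N^2/4 times the sum of the coefficients; that sum does not depend on
    N.\<close>
  define M where "M = real d / 4 * (\<Sum>\<xi>\<in>\<Xi>. c \<xi>)"
  have "\<beta> > 0" using m by (simp add: \<beta>_def)
  moreover have "M \<ge> 0" using c by (simp add: M_def sum_nonneg)
  moreover have "\<exists>H :: int ^ 'd \<Rightarrow> real.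
    (\<forall>x. 0 \<le> H x \<and> H x \<le> M \<and> H (torus_proj N x) = H x) \<and>
    (\<forall>x. torus_proj N x \<notin> box_B N \<longrightarrow> avg H x \<le> H x - \<beta> / (real N)\<^sup>2)" if N: "N \<ge> 1" for N
  proof -
    define G where "G = potential N \<Xi> c"
    have G: "\<And>x. 0 \<le> G x"
      "\<And>x. G x \<le> 2 * (\<Sum>\<xi>\<in>{\<xi>\<in>\<Xi>. symbol N \<xi> \<noteq> 1}. c \<xi> / (1 - symbol N \<xi>))"
      "\<And>x. G (torus_proj N x) = G x"
      "\<And>x. avg G x = G x - (\<Sum>\<xi>\<in>{\<xi>\<in>\<Xi>. symbol N \<xi> = 1}. c \<xi>) + (\<Sum>\<xi>\<in>\<Xi>. c \<xi> * wave N \<xi> x)"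
      unfolding G_def
      by (simp_all only: potential_nonneg potential_le potential_torus_proj avg_potential c N \<Xi>)
    define H where "H x = G x / (real N)\<^sup>2" for x
    have sN: "(real N)\<^sup>2 > 0" using N by simp
    have "G x \<le> M * (real N)\<^sup>2" for x
    proof -
      have "c \<xi> / (1 - symbol N \<xi>) \<le> c \<xi> * (real d * (real N)\<^sup>2 / 8)" if ne: "symbol N \<xi> \<noteq> 1" for \<xi>
      proof -
        have "\<exists>i. \<xi> $ i mod int N \<noteq> 0"
        proof (rule ccontr)
          assume "\<not> (\<exists>i. \<xi> $ i mod int N \<noteq> 0)"
          then have "tcos N (\<xi> $ i) = tcos N 0" for i by (intro tcos_cong[OF N]) simp
          then have "symbol N \<xi> = 1" by (simp add: symbol_def tcos_def)
          then show False using ne by simp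
        qed
        then obtain i where "\<xi> $ i mod int N \<noteq> 0" by blast
        then have "8 / (real N)\<^sup>2 / real d \<le> (1 - tcos N (\<xi> $ i)) / real d"
          by (intro divide_right_mono one_minus_tcos_ge'[OF N]) auto
        also have "\<dots> \<le> 1 - symbol N \<xi>" unfolding d_def by (rule one_minus_symbol_ge)
        finally have *: "8 / (real N)\<^sup>2 / real d \<le> 1 - symbol N \<xi>" .
        have "c \<xi> / (1 - symbol N \<xi>) \<le> c \<xi> / (8 / (real N)\<^sup>2 / real d)"
        proof (rule divide_left_mono[OF * c])
          have "0 < 8 / (real N)\<^sup>2 / real d" using sN d by simp
          then show "0 < (1 - symbol N \<xi>) * (8 / (real N)\<^sup>2 / real d)"
            using * by (intro mult_pos_pos) linarith+
        qed
        also have "c \<xi> / (8 / (real N)\<^sup>2 / real d) = c \<xi> * (real d * (real N)\<^sup>2 / 8)"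
          by simp
        finally show ?thesis .
      qed
      then have "(\<Sum>\<xi>\<in>{\<xi>\<in>\<Xi>. symbol N \<xi> \<noteq> 1}. c \<xi> / (1 - symbol N \<xi>))
          \<le> (\<Sum>\<xi>\<in>{\<xi>\<in>\<Xi>. symbol N \<xi> \<noteq> 1}. c \<xi> * (real d * (real N)\<^sup>2 / 8))"
        by (intro sum_mono) auto
      also have "\<dots> \<le> (\<Sum>\<xi>\<in>\<Xi>. c \<xi> * (real d * (real N)\<^sup>2 / 8))"
        using c \<Xi> by (intro sum_mono2) auto
      also have "\<dots> = (\<Sum>\<xi>\<in>\<Xi>. c \<xi>) * (real d * (real N)\<^sup>2 / 8)" by (simp add: sum_distrib_right)
      finally have "G x \<le> 2 * ((\<Sum>\<xi>\<in>\<Xi>. c \<xi>) * (real d * (real N)\<^sup>2 / 8))"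
        using G(2)[of x] by linarith
      then show ?thesis by (simp add: M_def mult_ac)
    qed
    then have HM: "H x \<le> M" for x using sN by (simp add: H_def field_simps)
    have avgH: "avg H x \<le> H x - \<beta> / (real N)\<^sup>2" if out: "torus_proj N x \<notin> box_B N" for x
    proof -
      have "0 \<in> \<Xi>" by (simp add: \<Xi>_def J_def)
      have sym0: "symbol N (0 :: int ^ 'd) = 1" by (simp add: symbol_def tcos_def)
      have "2 * \<beta> = (4 ^ m / (2 * real m)) ^ d" by (simp add: \<beta>_def)
      also have "\<dots> \<le> real ((2 * m) choose m) ^ d"
        using central_binomial_lower_bound[of m] m by (intro power_mono) auto
      also have "\<dots> = c 0" by (simp add: c_def w_def d_def)
      also have "\<dots> \<le> (\<Sum>\<xi>\<in>{\<xi>\<in>\<Xi>. symbol N \<xi> = 1}. c \<xi>)"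
        using \<Xi> c \<open>0 \<in> \<Xi>\<close> sym0 by (intro member_le_sum) auto
      finally have mean: "2 * \<beta> \<le> (\<Sum>\<xi>\<in>{\<xi>\<in>\<Xi>. symbol N \<xi> = 1}. c \<xi>)" .
      obtain i where "tcos N (x $ i) < sqrt 2 / 2"
        using out N by (auto simp: mem_box_B_iff not_le)
      moreover have "sqrt 2 \<le> 3 / 2" by (rule real_le_lsqrt) (auto simp: power2_eq_square)
      ultimately have i: "2 + 2 * tcos N (x $ i) \<le> 7 / 2" by simp
      have nn: "0 \<le> 2 + 2 * tcos N j" "2 + 2 * tcos N j \<le> 4" for j
        using tcos_ge_m1[of N j] tcos_le_1[of N j] by auto
      have "(\<Sum>\<xi>\<in>\<Xi>. c \<xi> * wave N \<xi> x) = (\<Prod>i\<in>UNIV. (2 + 2 * tcos N (x $ i)) ^ m)"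
        unfolding \<Xi>_def c_def sum_wave_prod[OF J] unfolding w_def J_def sum_binomial_cis
        by (simp add: tcos_def del: of_real_power flip: of_real_prod)
      \<comment> \<open>One coordinate violates the condition for B and contributes at most 7/2 to
        the power m; all others contribute at most 4^m.\<close>
      also have "\<dots> \<le> (\<Prod>j\<in>UNIV. if j = i then (7 / 2) ^ m else 4 ^ m)"
        using nn i by (intro prod_mono) (auto intro!: power_mono)
      also have "\<dots> = (7 / 2) ^ m * (\<Prod>j\<in>UNIV - {i}. 4 ^ m)"
        by (subst prod.remove[of _ i]) auto
      also have "\<dots> = (7 / 8) ^ m * (4 ^ m) ^ d"
      proof -
        have "(4 ^ m :: real) ^ d = 4 ^ m * (4 ^ m) ^ (d - 1)" using d by (cases d) auto
        moreover have "(7 / 8) ^ m * 4 ^ m = (7 / 2 :: real) ^ m" by (simp add: power_mult_distrib[symmetric])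
        ultimately show ?thesis by (simp add: d_def card_Diff_singleton mult.assoc[symmetric])
      qed
      also have "\<dots> \<le> \<beta>"
      proof -
        have "((2 * real m) ^ d * (7 / 8) ^ m) * (4 ^ m) ^ d \<le> 1 / 2 * (4 ^ m) ^ d"
          using m(2) by (intro mult_right_mono) auto
        then show ?thesis using m by (simp add: \<beta>_def power_divide field_simps)
      qed
      finally have "avg G x \<le> G x - \<beta>" using mean G(4)[of x] by simp
      moreover have "avg H x = avg G x / (real N)\<^sup>2"
        unfolding H_def using avg_cmult[of "1 / (real N)\<^sup>2" G x] by simp
      ultimately show ?thesis using sN by (simp add: H_def divide_right_mono diff_divide_distrib[symmetric])
    qed
    show ?thesis
      using G HM avgH sN by (intro exI[of _ H]) (auto simp: H_def)
  qed
  ultimately show ?thesis by blast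
qed

text \<open>The second difference of the cosine alone vanishes at the edge of the larger box, where
  the cosine is 0. Subtracting an eighth of the second harmonic adds a strictly negative
  contribution there without spoiling the interior.\<close>

lemma tcos_second_difference:
  assumes N: "N \<ge> 2" and pos: "0 \<le> tcos N j"
  defines "\<phi> \<equiv> \<lambda>j. tcos N j - tcos N (2 * j) / 8"
  shows "\<phi> (j + 1) + \<phi> (j - 1) - 2 * \<phi> j \<le> - (2 / (real N)\<^sup>2)"
proof -
  define t where "t = 2 * pi * of_int j / of_nat N"
  define \<theta> where "\<theta> = 2 * pi / real N"
  define C where "C = tcos N j"
  define u where "u = cos \<theta>"
  define \<kappa> where "\<kappa> = (1 + u) / 4"
  have C: "C = cos t" "0 \<le> C" "C \<le> 1" using pos by (auto simp: C_def tcos_def t_def)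
  have u1: "u = tcos N 1" by (simp add: u_def \<theta>_def tcos_def)
  have 1: "tcos N (j + 1) + tcos N (j - 1) = 2 * u * C"
    by (simp add: C u_def tcos_def t_def \<theta>_def add_divide_distrib diff_divide_distrib
        distrib_left right_diff_distrib cos_add cos_diff)
  have 2: "tcos N (2 * j) = 2 * C\<^sup>2 - 1"
  proof -
    have "tcos N (2 * j) = cos (2 * t)" by (simp add: tcos_def t_def)
    then show ?thesis by (simp add: cos_double_cos C)
  qed
  have 3: "tcos N (2 * (j + 1)) + tcos N (2 * (j - 1)) = 2 * (2 * u\<^sup>2 - 1) * (2 * C\<^sup>2 - 1)"
  proof -
    have "tcos N (2 * (j + 1)) = cos (2 * t + 2 * \<theta>)" "tcos N (2 * (j - 1)) = cos (2 * t - 2 * \<theta>)"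
      by (simp_all add: tcos_def t_def \<theta>_def add_divide_distrib diff_divide_distrib distrib_left right_diff_distrib)
    then have "tcos N (2 * (j + 1)) + tcos N (2 * (j - 1)) = 2 * cos (2 * \<theta>) * cos (2 * t)"
      by (simp add: cos_add cos_diff)
    then show ?thesis by (simp add: cos_double_cos C u_def)
  qed
  have eq: "\<phi> (j + 1) + \<phi> (j - 1) - 2 * \<phi> j = - 2 * (1 - u) * (C - \<kappa> * (2 * C\<^sup>2 - 1))"
  proof -
    have "\<phi> (j + 1) + \<phi> (j - 1) - 2 * \<phi> j
        = (tcos N (j + 1) + tcos N (j - 1)) - (tcos N (2 * (j + 1)) + tcos N (2 * (j - 1))) / 8
          - 2 * C + 2 * tcos N (2 * j) / 8"
      by (simp add: \<phi>_def C_def add_divide_distrib)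
    also have "\<dots> = 2 * u * C - 2 * (2 * u\<^sup>2 - 1) * (2 * C\<^sup>2 - 1) / 8 - 2 * C + 2 * (2 * C\<^sup>2 - 1) / 8"
      by (simp only: 1 2 3)
    also have "\<dots> = - 2 * (1 - u) * (C - \<kappa> * (2 * C\<^sup>2 - 1))"
      by (simp add: \<kappa>_def power2_eq_square field_simps)
    finally show ?thesis .
  qed
  have k1: "\<kappa> \<le> 1 / 2" by (simp add: \<kappa>_def u_def)
  have low: "1 / 8 \<le> C - \<kappa> * (2 * C\<^sup>2 - 1)"
  \<comment> \<open>For N = 2 the constant \<open>\<kappa>\<close> is 0, but the cosine takes only
    the values 1 and -1, so it equals 1 here. For N at least 3, cos (2 pi/N) is at least -1/2, hence
    \<open>\<kappa>\<close> is at least 1/8, and the expression equals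
    \<open>C * (1 - 2 * \<kappa> * C) + \<kappa>\<close>.\<close>
  proof (cases "N = 2")
    case True
    then have "t = pi * of_int j" by (simp add: t_def)
    then have "sin t = 0" by (auto simp: sin_zero_iff_int2 mult.commute)
    then have "C\<^sup>2 = 1" using sin_cos_squared_add[of t] by (simp add: C)
    then have "C = 1" using C by (simp add: power2_eq_1_iff)
    then show ?thesis using k1 by simp
  next
    case False
    then have "N \<ge> 3" using N by simp
    then have "\<theta> \<le> 2 * pi / 3" unfolding \<theta>_def by (intro divide_left_mono) auto
    moreover have "0 \<le> \<theta>" by (simp add: \<theta>_def)
    ultimately have "cos (2 * pi / 3) \<le> u" unfolding u_def by (intro cos_monotone_0_pi_le) auto
    then have k2: "1 / 8 \<le> \<kappa>" by (simp add: \<kappa>_def cos_120)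
    have "2 * \<kappa> * C \<le> 1 * 1" using k1 k2 C by (intro mult_mono) auto
    then have "0 \<le> C * (1 - 2 * \<kappa> * C)" using C by (intro mult_nonneg_nonneg) auto
    then show ?thesis using k2 by (simp add: algebra_simps power2_eq_square)
  qed
  have "1 mod int N \<noteq> 0" using N by simp
  then have "8 / (real N)\<^sup>2 \<le> 1 - u" unfolding u1 using N by (intro one_minus_tcos_ge') auto
  then have "8 / (real N)\<^sup>2 * (1 / 8) \<le> (1 - u) * (C - \<kappa> * (2 * C\<^sup>2 - 1))"
    using low by (intro mult_mono) (auto simp: u_def)
  then have "1 / (real N)\<^sup>2 \<le> (1 - u) * (C - \<kappa> * (2 * C\<^sup>2 - 1))" by simp
  then have "- 2 * ((1 - u) * (C - \<kappa> * (2 * C\<^sup>2 - 1))) \<le> - 2 * (1 / (real N)\<^sup>2)"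
    by (rule mult_left_mono_neg) simp
  then show ?thesis unfolding eq mult.assoc by simp
qed

text \<open>The phases are ordered by 1 <= \<open>G False\<close> <= 1 + K <= \<open>G True\<close>
  <= M. A departure therefore lowers \<open>G\<close>, and a return raises it by at most the factor
  M that the new power of 1/M absorbs. With fewer than k returns, \<open>V\<close> is still at least
  M^(-k).\<close>

lemma prob_few_returns_le:
  "\<exists>s M :: real. s > 0 \<and> M > 1 \<and> (\<forall>N n k. N \<ge> 2 \<longrightarrow>
    measure (torus_walk N :: (nat \<Rightarrow> int ^ 'd::finite) measure) {X. fst (cycle_state N (0, False) X n) < k}
      \<le> M ^ Suc k * exp (- (s * real n / (real N)\<^sup>2)))"
proof -
  define d where "d = real CARD('d)"
  have d: "d \<ge> 1" by (simp add: d_def Suc_leI)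
  obtain \<beta> K where \<beta>: "\<beta> > 0" "K \<ge> 0" and H: "\<And>N. N \<ge> 1 \<Longrightarrow> \<exists>H :: int ^ 'd::finite \<Rightarrow> real.
    (\<forall>x. 0 \<le> H x \<and> H x \<le> K \<and> H (torus_proj N x) = H x) \<and>
    (\<forall>x. torus_proj N x \<notin> box_B N \<longrightarrow> avg H x \<le> H x - \<beta> / (real N)\<^sup>2)"
    using superharmonic_off_box_B by metis
  \<comment> \<open>An upper bound for \<open>G True\<close>: the offset 1 + K + 2d plus a
    coordinate sum of at most 2d.\<close>
  define M where "M = 1 + K + 4 * d"
  \<comment> \<open>A drift of -e/N^2 contracts \<open>G\<close> by the factor 1 - s/N^2 once
    \<open>s * G\<close> is at most e. Here e = 1 against the bound M in one phase, and e =
    \<open>\<beta>\<close> against 1 + K in the other.\<close>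
  define s where "s = min (1 / M) (\<beta> / (1 + K))"
  have M: "M > 1" using \<beta> d by (simp add: M_def)
  have s: "s > 0" "s * M \<le> 1" "s * (1 + K) \<le> \<beta>" "s \<le> 1"
  proof -
    show "s > 0" using M \<beta> by (simp add: s_def)
    have "s \<le> 1 / M" "s \<le> \<beta> / (1 + K)" by (auto simp: s_def)
    then show "s * M \<le> 1" "s * (1 + K) \<le> \<beta>" using M \<beta> by (simp_all add: field_simps)
    have "1 / M \<le> 1" using M by simp
    then show "s \<le> 1" using \<open>s \<le> 1 / M\<close> by linarith
  qed
  have "measure (torus_walk N :: (nat \<Rightarrow> int ^ 'd) measure) {X. fst (cycle_state N (0, False) X n) < k}
      \<le> M ^ Suc k * exp (- (s * real n / (real N)\<^sup>2))" if N: "N \<ge> 2" for N n k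
  proof -
    have N1: "N \<ge> 1" using N by simp
    have sN: "(real N)\<^sup>2 \<ge> 1" using N by (simp add: one_le_power)
    obtain H where H: "\<And>x :: int ^ 'd. 0 \<le> H x" "\<And>x. H x \<le> K" "\<And>x. H (torus_proj N x) = H x"
      "\<And>x. torus_proj N x \<notin> box_B N \<Longrightarrow> avg H x \<le> H x - \<beta> / (real N)\<^sup>2"
      using H[OF N1] by blast
    define r where "r = 1 - s / (real N)\<^sup>2"
    have "s \<le> 1 * (real N)\<^sup>2" using s sN by linarith
    then have r: "r \<ge> 0" using N by (simp add: r_def pos_divide_le_eq)
    define \<phi> where "\<phi> j = tcos N j - tcos N (2 * j) / 8" for j
    define G where "G b y = (if b then 1 + K + 2 * d + (\<Sum>i\<in>UNIV. \<phi> (y $ i)) else 1 + H y)"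
      for b and y :: "int ^ 'd"
    define V where "V st y = (1 / M) ^ fst st * G (snd st) y" for st :: "nat \<times> bool" and y
    have \<phi>: "- 2 \<le> \<phi> j" "\<phi> j \<le> 2" for j
      using tcos_ge_m1[of N j] tcos_le_1[of N j] tcos_ge_m1[of N "2 * j"] tcos_le_1[of N "2 * j"]
      by (auto simp: \<phi>_def)
    have sum\<phi>: "- (2 * d) \<le> (\<Sum>i\<in>UNIV. \<phi> (y $ i))" "(\<Sum>i\<in>UNIV. \<phi> (y $ i)) \<le> 2 * d" for y :: "int ^ 'd"
      using sum_mono[of "UNIV :: 'd set" "\<lambda>_. - 2" "\<lambda>i. \<phi> (y $ i)"] \<phi>
        sum_mono[of "UNIV :: 'd set" "\<lambda>i. \<phi> (y $ i)" "\<lambda>_. 2"]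
      by (auto simp: d_def)
    have G: "1 + K \<le> G True y" "G True y \<le> M" "1 \<le> G False y" "G False y \<le> 1 + K" for y
      using sum\<phi>[of y] H(1,2)[of y] by (auto simp: G_def M_def)
    have per: "G b (torus_proj N y) = G b y" for b y
    proof -
      have "tcos N (2 * torus_proj N y $ i) = tcos N (2 * y $ i)" for i
        by (rule tcos_cong[OF N1]) (simp add: torus_proj_def mod_mult_right_eq)
      then show ?thesis using H(3) N1 by (simp add: G_def \<phi>_def)
    qed
    have contract: "f x - e / (real N)\<^sup>2 \<le> r * f x" if "s * f x \<le> e" for f :: "int ^ 'd \<Rightarrow> real" and x e
    proof -
      have "s * f x / (real N)\<^sup>2 \<le> e / (real N)\<^sup>2" using that by (intro divide_right_mono) auto
      then show ?thesis by (simp add: r_def algebra_simps)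
    qed
    have avgT: "avg (G True) y \<le> r * G True y" if inB: "torus_proj N y \<in> box_B_tilde N" for y
    proof -
      have eq: "G True = (\<lambda>y. (1 + K + 2 * d) + (\<Sum>i\<in>UNIV. \<phi> (y $ i)))" by (auto simp: G_def)
      have "avg (G True) y = G True y +
          (\<Sum>j\<in>UNIV. \<phi> (y $ j + 1) + \<phi> (y $ j - 1) - 2 * \<phi> (y $ j)) / (2 * d)"
        unfolding eq avg_add avg_coord_sum by (simp add: d_def)
      also have "\<dots> \<le> G True y + (\<Sum>j\<in>(UNIV :: 'd set). - (2 / (real N)\<^sup>2)) / (2 * d)"
        unfolding \<phi>_def using inB N N1 d
        by (intro add_left_mono divide_right_mono sum_mono tcos_second_difference)
           (auto simp: mem_box_B_tilde_iff)
      also have "\<dots> = G True y - 1 / (real N)\<^sup>2" using d by (simp add: d_def field_simps)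
      also have "\<dots> \<le> r * G True y"
        using mult_left_mono[OF G(2)[of y], of s] s by (intro contract) linarith
      finally show ?thesis .
    qed
    have avgF: "avg (G False) y \<le> r * G False y" if out: "torus_proj N y \<notin> box_B N" for y
    proof -
      have "G False = (\<lambda>y. 1 + H y)" by (auto simp: G_def)
      then have "avg (G False) y = 1 + avg H y" by (simp add: avg_add)
      also have "\<dots> \<le> G False y - \<beta> / (real N)\<^sup>2" using H(4)[OF out] by (simp add: G_def)
      also have "\<dots> \<le> r * G False y"
        using mult_left_mono[OF G(4)[of y], of s] s by (intro contract) linarith
      finally show ?thesis .
    qed
    have GM: "G True y / M \<le> 1" for y using G(2)[of y] M by simp
    have step: "V (cycle_step N st (torus_proj N z)) z \<le> (1 / M) ^ fst st * G (snd st) z" for st z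
    proof -
      have "G False z \<le> G True z" using G(1,4)[of z] by simp
      moreover have "G True z / M \<le> G False z" using GM[of z] G(3)[of z] by simp
      ultimately show ?thesis
        using M
        by (cases "torus_proj N z \<in> box_B_tilde N"; cases "torus_proj N z \<in> box_B N")
           (auto simp: V_def cycle_step_def field_simps)
    qed
    have "measure (torus_walk N :: (nat \<Rightarrow> int ^ 'd) measure) {X. cycle_state N (0, False) X n \<in> {st. fst st < k}}
      \<le> r ^ n * M / (1 / M) ^ k"
    proof (rule measure_cycle_state_le[where V = V, OF N1 _ r])
      have Gnn: "0 \<le> G b y" for b y using G[of y] \<beta> by (cases b) auto
      then show "V st y \<ge> 0" for st y using M by (simp add: V_def)
      show "V st (torus_proj N y) = V st y" for st y by (simp add: V_def per)
      show "avg (\<lambda>z. V (cycle_step N st (torus_proj N z)) z) y \<le> r * V st y"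
        if "if snd st then torus_proj N y \<in> box_B_tilde N else torus_proj N y \<notin> box_B N" for st y
      proof -
        have "avg (\<lambda>z. V (cycle_step N st (torus_proj N z)) z) y \<le> (1 / M) ^ fst st * avg (G (snd st)) y"
          unfolding avg_cmult[symmetric] by (intro avg_mono step)
        also have "\<dots> \<le> (1 / M) ^ fst st * (r * G (snd st) y)"
          using avgT[of y] avgF[of y] that M by (intro mult_left_mono) (cases "snd st"; simp)+
        finally show ?thesis by (simp add: V_def mult.left_commute)
      qed
      show "V (cycle_step N (0, False) (torus_proj N y)) y \<le> M" for y
        using step[of "(0, False)" y] G(4)[of y] d by (simp add: M_def)
      show "(1 / M) ^ k \<le> V st y" if "st \<in> {st. fst st < k}" for st y
      proof -
        have "(1 / M) ^ k \<le> (1 / M) ^ fst st" using that M by (intro power_decreasing) auto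
        moreover have "1 \<le> G (snd st) y" using G[of y] \<beta> by (cases "snd st") auto
        ultimately have "(1 / M) ^ k * 1 \<le> (1 / M) ^ fst st * G (snd st) y"
          using M by (intro mult_mono) auto
        then show ?thesis by (simp add: V_def)
      qed
      show "0 < (1 / M) ^ k" using M by simp
    qed
    also have "r ^ n * M / (1 / M) ^ k = M ^ Suc k * r ^ n" using M by (simp add: power_divide)
    also have "\<dots> \<le> M ^ Suc k * exp (- (s * real n / (real N)\<^sup>2))"
    proof (intro mult_left_mono)
      have "r ^ n \<le> exp (- (s / (real N)\<^sup>2)) ^ n"
        using r exp_ge_add_one_self[of "- (s / (real N)\<^sup>2)"] by (intro power_mono) (auto simp: r_def)
      also have "\<dots> = exp (- (s * real n / (real N)\<^sup>2))"
        by (simp add: exp_of_nat_mult[symmetric] mult.commute)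
      finally show "r ^ n \<le> exp (- (s * real n / (real N)\<^sup>2))" .
    qed (use M in auto)
    finally show ?thesis by simp
  qed
  then show ?thesis using s M by blast
qed

section \<open>Avoiding the origin\<close>

text \<open>Each term is at most an increment of \<open>z powr (1 - p) / (1 - p)\<close>, by the
  mean value theorem; the increments telescope.\<close>

lemma sum_powr_le:
  fixes p :: real
  assumes "0 \<le> p" "p < 1"
  shows "(\<Sum>k\<in>{1..n}. real k powr (- p)) \<le> real n powr (1 - p) / (1 - p)"
proof (induction n)
  case 0
  then show ?case by simp
next
  case (Suc n)
  have "real n powr (1 - p) + (1 - p) * real (Suc n) powr (- p) \<le> real (Suc n) powr (1 - p)"
  proof (cases "n = 0")
    case True
    then show ?thesis using assms by simp
  next
    case False
    have "\<exists>z>real n. z < real (Suc n) \<and>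
        real (Suc n) powr (1 - p) - real n powr (1 - p) = (real (Suc n) - real n) * ((1 - p) * z powr (1 - p - 1))"
    proof (rule MVT2)
      show "((\<lambda>z. z powr (1 - p)) has_real_derivative (1 - p) * x powr (1 - p - 1)) (at x)"
        if "real n \<le> x" for x
        using that False by (intro has_real_derivative_powr) simp
    qed simp
    then obtain z where z: "z > real n" "z < real (Suc n)"
      "real (Suc n) powr (1 - p) - real n powr (1 - p) = (1 - p) * z powr (- p)" by auto
    have "(1 - p) * real (Suc n) powr (- p) \<le> (1 - p) * z powr (- p)"
      using z False assms by (intro mult_left_mono powr_mono2') auto
    then show ?thesis using z by simp
  qed
  then have "real n powr (1 - p) / (1 - p) + real (Suc n) powr (- p) \<le> real (Suc n) powr (1 - p) / (1 - p)"
    using assms divide_right_mono[of "real n powr (1 - p) + (1 - p) * real (Suc n) powr (- p)"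
      "real (Suc n) powr (1 - p)" "1 - p"]
    by (simp add: add_divide_distrib)
  then show ?case using Suc by simp
qed

lemma torus_vec: "torus N = {\<xi> :: int ^ 'd. \<forall>i. \<xi> $ i \<in> {0..<int N}}"
  by (simp add: torus_def)

text \<open>
  The exponent \<open>2/d\<close> turns the bound of \<open>1 - symbol N \<xi>\<close> through the largest coordinate into a
  product over all coordinates, whose sum over the torus factorizes; \<open>2/d < 1\<close> is where \<open>d \<ge> 3\<close> enters.
\<close>

lemma sum_inverse_symbol_le:
  assumes d3: "CARD('d::finite) \<ge> 3"
  shows "\<exists>K>0. \<forall>N\<ge>1. (\<Sum>\<xi>\<in>{\<xi>\<in>(torus N :: (int ^ 'd) set). symbol N \<xi> \<noteq> 1}. 1 / (1 - symbol N \<xi>))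
    \<le> K * real N ^ CARD('d)"
proof -
  define d where "d = CARD('d)"
  have d: "d \<ge> 3" using d3 by (simp add: d_def)
  define p where "p = 2 / real d"
  have p: "0 < p" "p < 1" using d by (auto simp: p_def)
  define L where "L = 2 / (1 - p)"
  have L: "L > 0" using p by (simp add: L_def)
  define K where "K = real d / 2 * L ^ d"
  have "(\<Sum>\<xi>\<in>{\<xi>\<in>(torus N :: (int ^ 'd) set). symbol N \<xi> \<noteq> 1}. 1 / (1 - symbol N \<xi>)) \<le> K * real N ^ d"
    if N: "N \<ge> 1" for N
  proof -
    \<comment> \<open>Comparable to the cyclic distance of j from 0, but at least 1 also at j = 0,
      so that negative powers stay finite.\<close>
    define a where "a j = real_of_int (min (j + 1) (int N - j))" for j
    have a1: "a j \<ge> 1" if "j \<in> {0..<int N}" for j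
      using that by (simp add: a_def)
    have bound: "1 / (1 - symbol N \<xi>) \<le> real d * (real N)\<^sup>2 / 2 * (\<Prod>i\<in>UNIV. a (\<xi> $ i) powr (- p))"
      if \<xi>: "\<xi> \<in> torus N" and ne: "symbol N \<xi> \<noteq> 1" for \<xi> :: "int ^ 'd"
    proof -
      define m where "m i = min (\<xi> $ i) (int N - \<xi> $ i)" for i
      define k where "k = Max (range m)"
      have xi: "0 \<le> \<xi> $ i" "\<xi> $ i < int N" for i using \<xi> by (auto simp: torus_def)
      have k: "m i \<le> k" for i unfolding k_def by (rule Max_ge) auto
      have "k \<in> range m" unfolding k_def by (rule Max_in) auto
      then obtain i0 where i0: "k = m i0" by blast
      have "\<exists>i. \<xi> $ i \<noteq> 0"
      proof (rule ccontr)
        assume "\<not> (\<exists>i. \<xi> $ i \<noteq> 0)"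
        then have "symbol N \<xi> = 1" by (simp add: symbol_def tcos_def)
        then show False using ne by simp
      qed
      then obtain i1 where "\<xi> $ i1 \<noteq> 0" by blast
      then have "1 \<le> m i1" using xi[of i1] by (simp add: m_def)
      then have k1: "1 \<le> k" using k[of i1] by simp
      have a_le: "a (\<xi> $ i) \<le> 2 * real_of_int k" for i
      proof -
        have "min (\<xi> $ i + 1) (int N - \<xi> $ i) \<le> 2 * k"
          using k[of i] k1 unfolding m_def by linarith
        then show ?thesis unfolding a_def by linarith
      qed
      have tc: "8 * (real_of_int k)\<^sup>2 / (real N)\<^sup>2 \<le> 1 - tcos N (\<xi> $ i0)"
      proof (cases "\<xi> $ i0 \<le> int N - \<xi> $ i0")
        case True
        then have "k = \<xi> $ i0" by (simp add: i0 m_def)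
        then show ?thesis using True xi[of i0] one_minus_tcos_ge[OF N, of "\<xi> $ i0"] by simp
      next
        case False
        then have k': "k = int N - \<xi> $ i0" by (simp add: i0 m_def)
        have "tcos N (\<xi> $ i0 - int N) = tcos N (\<xi> $ i0)"
          by (rule tcos_cong[OF N]) simp
        then show ?thesis
          using False xi[of i0] one_minus_tcos_ge[OF N, of "\<xi> $ i0 - int N"]
          by (simp add: k' power2_commute)
      qed
      \<comment> \<open>All factors are at most 2k, where k is the largest cyclic distance, and d
        factors with exponent 2/d give (2k)^2, the order of \<open>1 - symbol N \<xi>\<close> times
        N^2.\<close>
      have "(\<Prod>i\<in>(UNIV :: 'd set). a (\<xi> $ i) powr p) \<le> (\<Prod>i\<in>(UNIV :: 'd set). (2 * real_of_int k) powr p)"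
        using a_le a1 xi p
        by (intro prod_mono) (auto intro!: powr_mono2 order_trans[OF _ a1])
      also have "\<dots> = ((2 * real_of_int k) powr p) powr real d"
        using k1 by (simp add: d_def powr_realpow)
      also have "\<dots> = (2 * real_of_int k)\<^sup>2"
        using k1 d by (simp add: powr_powr p_def)
      finally have P: "(\<Prod>i\<in>(UNIV :: 'd set). a (\<xi> $ i) powr p) \<le> 4 * (real_of_int k)\<^sup>2"
        by (simp add: power_mult_distrib)
      have apos: "0 < a (\<xi> $ i)" for i using a1[of "\<xi> $ i"] xi[of i] by simp
      have Ppos: "0 < (\<Prod>i\<in>(UNIV :: 'd set). a (\<xi> $ i) powr p)"
        by (intro prod_pos) (simp add: apos less_imp_neq[OF apos, symmetric])
      have "2 * (\<Prod>i\<in>(UNIV :: 'd set). a (\<xi> $ i) powr p) / (real N)\<^sup>2 / real d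
          \<le> 8 * (real_of_int k)\<^sup>2 / (real N)\<^sup>2 / real d"
        using P by (intro divide_right_mono) auto
      also have "\<dots> \<le> (1 - tcos N (\<xi> $ i0)) / real d"
        using tc by (intro divide_right_mono) auto
      also have "\<dots> \<le> 1 - symbol N \<xi>" unfolding d_def by (rule one_minus_symbol_ge)
      finally have *: "2 * (\<Prod>i\<in>(UNIV :: 'd set). a (\<xi> $ i) powr p) / (real N)\<^sup>2 / real d \<le> 1 - symbol N \<xi>" .
      moreover have pos: "0 < 2 * (\<Prod>i\<in>(UNIV :: 'd set). a (\<xi> $ i) powr p) / (real N)\<^sup>2 / real d"
        using Ppos N d by simp
      ultimately have "1 / (1 - symbol N \<xi>)
          \<le> 1 / (2 * (\<Prod>i\<in>(UNIV :: 'd set). a (\<xi> $ i) powr p) / (real N)\<^sup>2 / real d)"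
        by (intro divide_left_mono mult_pos_pos) linarith+
      also have "\<dots> = real d * (real N)\<^sup>2 / 2 * inverse (\<Prod>i\<in>(UNIV :: 'd set). a (\<xi> $ i) powr p)"
      proof -
        have "1 / (2 * q / s / e) = e * s / 2 * inverse q" for q s e :: real
          by (simp add: inverse_eq_divide)
        then show ?thesis .
      qed
      also have "inverse (\<Prod>i\<in>(UNIV :: 'd set). a (\<xi> $ i) powr p) = (\<Prod>i\<in>UNIV. a (\<xi> $ i) powr (- p))"
        by (simp add: prod_inversef[symmetric] powr_minus comp_def)
      finally show ?thesis .
    qed
    have S: "(\<Sum>j\<in>{0..<int N}. a j powr (- p)) \<le> L * real N powr (1 - p)"
    proof -
      \<comment> \<open>A negative power of a minimum is at most the sum of the two negative
        powers.\<close>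
      have "(\<Sum>j\<in>{0..<int N}. a j powr (- p))
          \<le> (\<Sum>j\<in>{0..<int N}. real_of_int (j + 1) powr (- p) + real_of_int (int N - j) powr (- p))"
        by (intro sum_mono) (auto simp: a_def min_def)
      also have "\<dots> = (\<Sum>k\<in>{1..N}. real k powr (- p)) + (\<Sum>k\<in>{1..N}. real k powr (- p))"
        unfolding sum.distrib
      proof (intro arg_cong2[where f = "(+)"])
        show "(\<Sum>j\<in>{0..<int N}. real_of_int (j + 1) powr (- p)) = (\<Sum>k\<in>{1..N}. real k powr (- p))"
          by (rule sum.reindex_bij_witness[where i = "\<lambda>k. int k - 1" and j = "\<lambda>j. nat (j + 1)"]) auto
        show "(\<Sum>j\<in>{0..<int N}. real_of_int (int N - j) powr (- p)) = (\<Sum>k\<in>{1..N}. real k powr (- p))"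
          by (rule sum.reindex_bij_witness[where i = "\<lambda>k. int N - int k" and j = "\<lambda>j. nat (int N - j)"]) auto
      qed
      also have "\<dots> \<le> L * real N powr (1 - p)"
        using sum_powr_le[of p N] p by (simp add: L_def field_simps)
      finally show ?thesis .
    qed
    have "(\<Sum>\<xi>\<in>{\<xi>\<in>(torus N :: (int ^ 'd) set). symbol N \<xi> \<noteq> 1}. 1 / (1 - symbol N \<xi>))
        \<le> (\<Sum>\<xi>\<in>{\<xi>\<in>(torus N :: (int ^ 'd) set). symbol N \<xi> \<noteq> 1}.
            real d * (real N)\<^sup>2 / 2 * (\<Prod>i\<in>UNIV. a (\<xi> $ i) powr (- p)))"
      using bound by (intro sum_mono) auto
    also have "\<dots> \<le> (\<Sum>\<xi>\<in>(torus N :: (int ^ 'd) set). real d * (real N)\<^sup>2 / 2 * (\<Prod>i\<in>UNIV. a (\<xi> $ i) powr (- p)))"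
      by (intro sum_mono2 finite_torus) (auto intro!: mult_nonneg_nonneg prod_nonneg)
    also have "\<dots> = real d * (real N)\<^sup>2 / 2 * (\<Prod>i\<in>(UNIV :: 'd set). \<Sum>j\<in>{0..<int N}. a j powr (- p))"
      unfolding sum_distrib_left[symmetric] torus_vec by (subst sum_vec_prod) auto
    also have "\<dots> = real d * (real N)\<^sup>2 / 2 * (\<Sum>j\<in>{0..<int N}. a j powr (- p)) ^ d"
      by (simp add: d_def)
    also have "\<dots> \<le> real d * (real N)\<^sup>2 / 2 * (L * real N powr (1 - p)) ^ d"
      using S by (intro mult_left_mono power_mono sum_nonneg) auto
    also have "(L * real N powr (1 - p)) ^ d = L ^ d * (real N powr ((1 - p) * real d))"
      using N by (simp add: power_mult_distrib powr_realpow[symmetric] powr_powr)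
    \<comment> \<open>With p = 2/d the torus sum has order N^(d-2), and the prefactor N^2 brings it
      to N^d.\<close>
    also have "(1 - p) * real d = real (d - 2)"
      using d by (simp add: p_def field_simps of_nat_diff)
    also have "real d * (real N)\<^sup>2 / 2 * (L ^ d * real N powr real (d - 2)) = K * real N ^ d"
    proof -
      have "real N powr real (d - 2) = real N ^ (d - 2)" using N by (simp add: powr_realpow)
      moreover have "(real N)\<^sup>2 * real N ^ (d - 2) = real N ^ d"
      proof -
        have "2 + (d - 2) = d" using d by simp
        then show ?thesis by (metis power_add)
      qed
      ultimately show ?thesis by (simp add: K_def mult_ac)
    qed
    finally show ?thesis .
  qed
  moreover have "K > 0" using L d by (simp add: K_def)
  ultimately show ?thesis unfolding d_def by blast
qed

section \<open>Poisson equation for the point mass at the origin\<close>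

lemma sum_cis_multiples:
  assumes "N \<ge> 1" "y mod int N \<noteq> 0"
  shows "(\<Sum>j\<in>{0..<int N}. cis (of_int j * (2 * pi * of_int y / of_nat N))) = 0"
proof -
  define t where "t = 2 * pi * of_int y / of_nat N"
  have ne: "cis t \<noteq> 1"
  proof
    assume "cis t = 1"
    then have "tcos N y = 1" by (simp add: complex_eq_iff tcos_def t_def)
    moreover have "8 / (real N)\<^sup>2 \<le> 1 - tcos N y" by (rule one_minus_tcos_ge'[OF assms])
    ultimately show False using assms by simp
  qed
  have "(\<Sum>j\<in>{0..<int N}. cis (of_int j * t)) = (\<Sum>k<N. cis t ^ k)"
    by (rule sum.reindex_bij_witness[where i = int and j = nat]) (auto simp: Complex.DeMoivre)
  also have "\<dots> = (cis t ^ N - 1) / (cis t - 1)" by (rule geometric_sum[OF ne])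
  also have "cis t ^ N = cis (2 * pi * of_int y)"
    using assms(1) by (simp add: Complex.DeMoivre t_def)
  also have "\<dots> = 1" by (simp add: complex_eq_iff)
  finally show ?thesis by (simp add: t_def)
qed

text \<open>Orthogonality of characters: with all coefficients 1 the polynomial of
  \<open>avg_potential\<close> is N^d times the point mass at 0.\<close>

lemma sum_torus_wave:
  assumes "N \<ge> 1" "torus_proj N x \<noteq> 0"
  shows "(\<Sum>\<xi>\<in>torus N. wave N \<xi> x) = 0"
proof -
  obtain i where i: "x $ i mod int N \<noteq> 0" using assms(2) by (auto simp: torus_proj_def vec_eq_iff)
  have prod: "(\<Prod>i\<in>UNIV. \<Sum>j\<in>{0..<int N}. of_real 1 * cis (of_int j * (2 * pi * of_int (x $ i) / of_nat N))) = 0"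
    using sum_cis_multiples[OF assms(1) i] by (intro prod_zero bexI[of _ i]) (auto simp del: times_divide_eq_right)
  have "(\<Sum>\<xi>\<in>torus N. (\<Prod>i\<in>(UNIV :: 'a set). 1) * wave N \<xi> x) = Re 0"
    unfolding torus_vec prod[symmetric] by (rule sum_wave_prod) simp
  then show ?thesis by simp
qed

text \<open>Off 0 the polynomial with coefficients 1 vanishes while its mean is at least 1, so the
  potential has drift at most -1 there. Divided by N^d it stays bounded, and adding 1 makes this
  additive drift comparable to \<open>G\<close> itself.\<close>

lemma superharmonic_off_origin:
  assumes d3: "CARD('d::finite) \<ge> 3"
  shows "\<exists>M\<ge>2. \<forall>N\<ge>1. \<exists>G :: int ^ 'd \<Rightarrow> real. (\<forall>x. 1 \<le> G x \<and> G x \<le> M) \<and>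
    (\<forall>x. torus_proj N x \<noteq> 0 \<longrightarrow> avg G x \<le> (1 - 1 / (M * real N ^ CARD('d))) * G x)"
proof -
  obtain K where K: "K > 0" "\<And>N. N \<ge> 1 \<Longrightarrow> (\<Sum>\<xi>\<in>{\<xi>\<in>(torus N :: (int ^ 'd) set). symbol N \<xi> \<noteq> 1}. 1 / (1 - symbol N \<xi>))
    \<le> K * real N ^ CARD('d)"
    using sum_inverse_symbol_le[OF d3] by blast
  \<comment> \<open>1 + 2K bounds \<open>G\<close>; the further 1 gives \<open>M \<ge> 2\<close>,
    which keeps 1 - 1/(M N^d) at least 1/2 for every N.\<close>
  define M where "M = 2 + 2 * K"
  have "\<exists>G :: int ^ 'd \<Rightarrow> real. (\<forall>x. 1 \<le> G x \<and> G x \<le> M) \<and>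
    (\<forall>x. torus_proj N x \<noteq> 0 \<longrightarrow> avg G x \<le> (1 - 1 / (M * real N ^ CARD('d))) * G x)" if N: "N \<ge> 1" for N
  proof (intro exI conjI allI impI)
    define D where "D = real N ^ CARD('d)"
    have D: "D > 0" using N by (simp add: D_def)
    define H where "H = potential N (torus N :: (int ^ 'd) set) (\<lambda>_. 1)"
    define G where "G x = 1 + 1 / D * H x" for x
    have H0: "0 \<le> H x" for x unfolding H_def by (rule potential_nonneg) simp
    have HK: "H x \<le> 2 * K * D" for x
      unfolding H_def
      using K(2)[OF N] potential_le[of "\<lambda>_. 1" N "torus N" x] by (simp add: D_def)
    show "1 \<le> G x" for x using H0[of x] D by (simp add: G_def)
    have "H x / D \<le> 2 * K" for x using HK[of x] D by (simp add: field_simps)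
    then show GM: "G x \<le> M" for x by (simp add: G_def M_def add_increasing)
    fix x :: "int ^ 'd" assume x: "torus_proj N x \<noteq> 0"
    have avgH: "avg H x \<le> H x - 1"
    proof -
      have "(0 :: int ^ 'd) \<in> {\<xi>\<in>torus N. symbol N \<xi> = 1}"
        using N by (simp add: torus_def symbol_def tcos_def)
      then have "1 \<le> (\<Sum>\<xi>\<in>{\<xi>\<in>(torus N :: (int ^ 'd) set). symbol N \<xi> = 1}. 1 :: real)"
        by (intro member_le_sum[of _ _ "\<lambda>_. 1"]) (auto simp: finite_torus)
      moreover have "avg H x = H x - (\<Sum>\<xi>\<in>{\<xi>\<in>(torus N :: (int ^ 'd) set). symbol N \<xi> = 1}. 1)
          + (\<Sum>\<xi>\<in>torus N. 1 * wave N \<xi> x)"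
        unfolding H_def by (rule avg_potential[OF N finite_torus])
      ultimately show ?thesis using sum_torus_wave[OF N x] by simp
    qed
    have "avg G x = 1 + 1 / D * avg H x"
      unfolding G_def avg_add avg_cmult by simp
    also have "\<dots> \<le> 1 + 1 / D * (H x - 1)"
      using avgH D by (intro add_left_mono mult_left_mono) auto
    also have "\<dots> = G x - 1 / D" by (simp add: G_def algebra_simps)
    also have "\<dots> \<le> G x - G x / (M * D)"
    proof -
      have "G x / (M * D) \<le> M / (M * D)" using GM D K by (intro divide_right_mono) (auto simp: M_def)
      also have "\<dots> = 1 / D" using K by (simp add: M_def)
      finally show ?thesis by simp
    qed
    finally show "avg G x \<le> (1 - 1 / (M * real N ^ CARD('d))) * G x"
      by (simp add: D_def algebra_simps)
  qed
  moreover have "M \<ge> 2" using K by (simp add: M_def)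
  ultimately show ?thesis by blast
qed

section \<open>Reversibility and log-convexity for the killed walk\<close>

lemma avoid_torus_proj: "avoid N n (torus_proj N x) = avoid N n x"
proof (induction n arbitrary: x)
  case 0
  then show ?case by simp
next
  case (Suc n)
  have "avoid N n (torus_proj N x + y) = avoid N n (x + y)" for y
    by (metis Suc torus_proj_add)
  then have "avg (avoid N n) (torus_proj N x) = avg (avoid N n) x"
    by (simp add: avg_unit_steps)
  then show ?case by simp
qed

lemma avoid_le_1: "avoid N n x \<le> 1"
proof (induction n arbitrary: x)
  case (Suc n)
  have "avg (avoid N n) x \<le> avg (\<lambda>_. 1) x" by (rule avg_mono) (rule Suc)
  then show ?case by simp
qed simp

lemma avoid_Suc_le: "avoid N (Suc n) x \<le> avoid N n x"
proof (induction n arbitrary: x)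
  case 0
  have "avg (avoid N 0) x \<le> avg (\<lambda>_. 1) x" by (rule avg_mono) (rule avoid_le_1)
  then show ?case by simp
next
  case (Suc n)
  have "avg (avoid N (Suc n)) x \<le> avg (avoid N n) x" by (rule avg_mono) (rule Suc)
  then show ?case by simp
qed

lemma sum_torus_shift:
  assumes N: "N \<ge> 1" and per: "\<And>x. f (torus_proj N x) = f x"
  shows "(\<Sum>x\<in>torus N. f (x + e)) = (\<Sum>x\<in>torus N. f x)"
proof (rule sum.reindex_bij_witness[where i = "\<lambda>x. torus_proj N (x - e)" and j = "\<lambda>x. torus_proj N (x + e)"])
  show "torus_proj N (torus_proj N (x + e) - e) = x" if "x \<in> torus N" for x
    using torus_proj_add[of N "x + e" "- e"] torus_proj_id[OF that] by simp
  show "torus_proj N (torus_proj N (x - e) + e) = x" if "x \<in> torus N" for x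
    using torus_proj_add[of N "x - e" e] torus_proj_id[OF that] by simp
qed (auto simp: torus_proj_in_torus[OF N] per)

text \<open>Translating the summation variable moves a step from one factor to the other with
  opposite sign, and the step law is symmetric.\<close>

lemma avg_symmetric:
  fixes f g :: "int ^ 'd::finite \<Rightarrow> real"
  assumes N: "N \<ge> 1" and f: "\<And>x. f (torus_proj N x) = f x" and g: "\<And>x. g (torus_proj N x) = g x"
  shows "(\<Sum>x\<in>torus N. f x * avg g x) = (\<Sum>x\<in>torus N. avg f x * g x)"
proof -
  have shift: "(\<Sum>x\<in>torus N. f x * g (x + e)) = (\<Sum>x\<in>torus N. f (x - e) * g x)" for e
  proof -
    have per: "h (torus_proj N x - e) = h (x - e)" if "\<And>x. h (torus_proj N x) = h x" for h :: "int ^ 'd \<Rightarrow> real" and x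
      using that torus_proj_add[of N x "- e"] by (metis diff_conv_add_uminus)
    have "(\<Sum>x\<in>torus N. (\<lambda>x. f (x - e) * g x) (x + e)) = (\<Sum>x\<in>torus N. f (x - e) * g x)"
      by (rule sum_torus_shift[OF N]) (simp add: per f g)
    then show ?thesis by simp
  qed
  have shift': "(\<Sum>x\<in>torus N. f x * g (x - e)) = (\<Sum>x\<in>torus N. f (x + e) * g x)" for e
    using shift[of "- e"] by simp
  have "(\<Sum>x\<in>torus N. f x * avg g x) =
      (\<Sum>i\<in>UNIV. (\<Sum>x\<in>torus N. f x * g (x + axis i 1)) + (\<Sum>x\<in>torus N. f x * g (x - axis i 1))) / (2 * real CARD('d))"
    unfolding avg_def
    by (simp add: sum_divide_distrib[symmetric] sum_distrib_left sum.swap[of _ "torus N"] sum.distrib[symmetric] distrib_left)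
  also have "\<dots> = (\<Sum>i\<in>UNIV. (\<Sum>x\<in>torus N. f (x - axis i 1) * g x) + (\<Sum>x\<in>torus N. f (x + axis i 1) * g x)) / (2 * real CARD('d))"
    by (simp only: shift shift')
  also have "\<dots> = (\<Sum>x\<in>torus N. avg f x * g x)"
    unfolding avg_def
    by (simp add: sum_divide_distrib[symmetric] sum_distrib_right sum.swap[of _ "torus N"] sum.distrib[symmetric] distrib_right add.commute)
  finally show ?thesis .
qed

text \<open>N^d times the probability that the uniformly started walk avoids 0 through time
  n.\<close>

definition avoid_mass :: "'d::finite itself \<Rightarrow> nat \<Rightarrow> nat \<Rightarrow> real" where
  "avoid_mass _ N n = (\<Sum>x\<in>(torus N :: (int ^ 'd::finite) set). avoid N n x)"

text \<open>With Q the kernel killed at 0, \<open>avoid N n\<close> is Q^n applied to the indicator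
  of the complement of 0. Q is symmetric, so powers can be moved across the inner product.\<close>

lemma sum_avoid_mult:
  assumes N: "N \<ge> 1"
  shows "(\<Sum>x\<in>(torus N :: (int ^ 'd::finite) set). avoid N m x * avoid N n x) = avoid_mass TYPE('d) N (m + n)"
proof (induction n arbitrary: m)
  case 0
  have "avoid N m x * avoid N 0 x = avoid N m x" for x :: "int ^ 'd"
    by (cases m) auto
  then show ?case by (simp only: avoid_mass_def add_0_right)
next
  case (Suc n)
  have 1: "avoid N m x * avoid N (Suc n) x = avoid N m x * avg (avoid N n) x" for x :: "int ^ 'd"
    by (cases m) auto
  have 2: "avg (avoid N m) x * avoid N n x = avoid N (Suc m) x * avoid N n x" for x :: "int ^ 'd"
    by (cases n) auto
  have "(\<Sum>x\<in>(torus N :: (int ^ 'd) set). avoid N m x * avoid N (Suc n) x)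
      = (\<Sum>x\<in>(torus N :: (int ^ 'd) set). avoid N m x * avg (avoid N n) x)" by (simp only: 1)
  also have "\<dots> = (\<Sum>x\<in>(torus N :: (int ^ 'd) set). avg (avoid N m) x * avoid N n x)"
    by (rule avg_symmetric[OF N]) (rule avoid_torus_proj)+
  also have "\<dots> = (\<Sum>x\<in>(torus N :: (int ^ 'd) set). avoid N (Suc m) x * avoid N n x)" by (simp only: 2)
  also have "\<dots> = avoid_mass TYPE('d) N (Suc m + n)" by (rule Suc)
  finally show ?case by simp
qed

lemma avoid_mass_log_convex:
  assumes N: "N \<ge> 1"
  shows "(avoid_mass TYPE('d::finite) N (m + n))\<^sup>2 \<le> avoid_mass TYPE('d) N (2 * m) * avoid_mass TYPE('d) N (2 * n)"
  using Cauchy_Schwarz_ineq_sum[of "avoid N m" "avoid N n" "torus N :: (int ^ 'd) set"]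
  by (simp add: sum_avoid_mult[OF N] power2_eq_square mult_2)

lemma avoid_mass_nonneg: "avoid_mass TYPE('d::finite) N n \<ge> 0"
  by (simp add: avoid_mass_def sum_nonneg avoid_nonneg)

lemma avoid_mass_antimono: "m \<le> n \<Longrightarrow> avoid_mass TYPE('d::finite) N n \<le> avoid_mass TYPE('d) N m"
  by (rule lift_Suc_antimono_le[of "avoid_mass TYPE('d) N"])
     (auto simp: avoid_mass_def simp del: avoid.simps intro!: sum_mono avoid_Suc_le)

lemma avoid_mass_0:
  assumes "N \<ge> 1"
  shows "avoid_mass TYPE('d::finite) N 0 = real N ^ CARD('d) - 1"
proof -
  have "avoid_mass TYPE('d) N 0 = (\<Sum>x\<in>(torus N :: (int ^ 'd) set). 1 - (if x = 0 then 1 else 0))"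
    unfolding avoid_mass_def by (intro sum.cong) (auto simp: torus_proj_id)
  also have "\<dots> = real (card (torus N :: (int ^ 'd) set)) - 1"
    using assms by (simp add: sum_subtractf finite_torus) (simp add: torus_def)
  finally show ?thesis by (simp add: card_torus)
qed

text \<open>Averaging preserves the total over the torus; each step removes only the value at 0,
  which is at most 1.\<close>

lemma avoid_mass_Suc_ge:
  assumes N: "N \<ge> 1"
  shows "avoid_mass TYPE('d::finite) N n - 1 \<le> avoid_mass TYPE('d) N (Suc n)"
proof -
  have "avoid_mass TYPE('d) N n = (\<Sum>x\<in>(torus N :: (int ^ 'd) set). 1 * avoid N n x)"
    by (simp add: avoid_mass_def)
  also have "\<dots> = (\<Sum>x\<in>(torus N :: (int ^ 'd) set). 1 * avg (avoid N n) x)"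
    using avg_symmetric[OF N, of "\<lambda>_. 1" "avoid N n :: int ^ 'd \<Rightarrow> real"] by (simp add: avoid_torus_proj)
  also have "\<dots> \<le> (\<Sum>x\<in>(torus N :: (int ^ 'd) set). avoid N (Suc n) x + (if x = 0 then 1 else 0))"
  proof (intro sum_mono)
    fix x :: "int ^ 'd" assume x: "x \<in> torus N"
    have "avg (avoid N n) x \<le> avg (\<lambda>_. 1) x" by (rule avg_mono) (rule avoid_le_1)
    then show "1 * avg (avoid N n) x \<le> avoid N (Suc n) x + (if x = 0 then 1 else 0)"
      using x by (cases "x = 0") (auto simp: torus_proj_id)
  qed
  also have "\<dots> = avoid_mass TYPE('d) N (Suc n) + 1"
    using N by (simp add: sum.distrib avoid_mass_def finite_torus del: avoid.simps) (simp add: torus_def)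
  finally show ?thesis by simp
qed

text \<open>The contraction off 0 iterates to \<open>avoid N n x \<le> \<rho> ^ n * G x\<close>,
  since \<open>avoid\<close> vanishes at 0.\<close>

lemma avoid_mass_le_exponential:
  assumes "CARD('d::finite) \<ge> 3"
  shows "\<exists>M\<ge>2. \<forall>N\<ge>1. \<forall>n. avoid_mass TYPE('d) N n
    \<le> M * real N ^ CARD('d) * (1 - 1 / (M * real N ^ CARD('d))) ^ n"
proof -
  obtain M where M: "M \<ge> 2" and ex: "\<And>N. N \<ge> 1 \<Longrightarrow> \<exists>G :: int ^ 'd \<Rightarrow> real. (\<forall>x. 1 \<le> G x \<and> G x \<le> M) \<and>
    (\<forall>x. torus_proj N x \<noteq> 0 \<longrightarrow> avg G x \<le> (1 - 1 / (M * real N ^ CARD('d))) * G x)"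
    using superharmonic_off_origin[OF assms] by blast
  have "avoid_mass TYPE('d) N n \<le> M * real N ^ CARD('d) * (1 - 1 / (M * real N ^ CARD('d))) ^ n"
    if N: "N \<ge> 1" for N n
  proof -
    define \<rho> where "\<rho> = 1 - 1 / (M * real N ^ CARD('d))"
    obtain G :: "int ^ 'd \<Rightarrow> real" where G: "\<And>x. 1 \<le> G x" "\<And>x. G x \<le> M"
      "\<And>x. torus_proj N x \<noteq> 0 \<Longrightarrow> avg G x \<le> \<rho> * G x"
      using ex[OF N] unfolding \<rho>_def by blast
    have "1 * 1 \<le> M * real N ^ CARD('d)" using M N by (intro mult_mono) (auto simp: one_le_power)
    then have \<rho>: "\<rho> \<ge> 0" by (simp add: \<rho>_def)
    have le: "avoid N n x \<le> \<rho> ^ n * G x" for n x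
    proof (induction n arbitrary: x)
      case 0
      show ?case using G(1)[of x] by simp
    next
      case (Suc n)
      show ?case
      proof (cases "torus_proj N x = 0")
        case True
        then show ?thesis using \<rho> G(1)[of x] by simp
      next
        case False
        have "avg (avoid N n) x \<le> avg (\<lambda>y. \<rho> ^ n * G y) x" by (rule avg_mono) (rule Suc)
        also have "\<dots> = \<rho> ^ n * avg G x" by (rule avg_cmult)
        also have "\<dots> \<le> \<rho> ^ n * (\<rho> * G x)" using \<rho> G(3)[OF False] by (intro mult_left_mono) auto
        finally show ?thesis using False by (simp add: mult_ac)
      qed
    qed
    have "avoid_mass TYPE('d) N n \<le> (\<Sum>x\<in>(torus N :: (int ^ 'd) set). \<rho> ^ n * M)"
      unfolding avoid_mass_def using le \<rho> G(2)
      by (intro sum_mono order_trans[OF le]) (simp add: mult_left_mono)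
    also have "\<dots> = M * real N ^ CARD('d) * \<rho> ^ n" by (simp add: card_torus)
    finally show ?thesis by (simp add: \<rho>_def)
  qed
  then show ?thesis using M by blast
qed

text \<open>Successive ratios are nondecreasing, hence all at least the first. They are handled
  without division because terms may vanish.\<close>

lemma log_convex_ge:
  fixes a :: "nat \<Rightarrow> real"
  assumes nonneg: "\<And>k. a k \<ge> 0" and convex: "\<And>k. (a (Suc k))\<^sup>2 \<le> a k * a (Suc (Suc k))"
    and r: "r \<ge> 0" "r * a 0 \<le> a 1"
  shows "r ^ k * a 0 \<le> a k"
proof -
  have ratio: "r * a k \<le> a (Suc k)" for k
  proof (induction k)
    case (Suc k)
    show ?case
    proof (cases "a (Suc k) = 0")
      case True
      then show ?thesis using nonneg by simp
    next
      case False
      then have pos: "a (Suc k) > 0" using nonneg[of "Suc k"] by simp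
      then have "0 < a k * a (Suc (Suc k))" using convex[of k] by (smt (verit) zero_less_power2)
      then have ak: "a k > 0" using nonneg[of k] by (simp add: zero_less_mult_iff)
      have "a k * (r * a (Suc k)) = (r * a k) * a (Suc k)" by simp
      also have "\<dots> \<le> a (Suc k) * a (Suc k)" using Suc pos by (intro mult_right_mono) auto
      also have "\<dots> \<le> a k * a (Suc (Suc k))" using convex[of k] by (simp add: power2_eq_square)
      finally show ?thesis using ak by simp
    qed
  qed (use r in simp)
  show ?thesis
  proof (induction k)
    case (Suc k)
    have "r ^ Suc k * a 0 \<le> r * a k" using mult_left_mono[OF Suc r(1)] by (simp add: mult.assoc)
    then show ?case using ratio[of k] by simp
  qed simp
qed

text \<open>
  The ratios of a log-convex sequence increase, so a single ratio above \<open>\<rho>\<close> would already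
  contradict the exponential bound; this removes the constant \<open>C\<close>.
\<close>

lemma log_convex_le:
  fixes a :: "nat \<Rightarrow> real"
  assumes nonneg: "\<And>k. a k \<ge> 0" and convex: "\<And>k. (a (Suc k))\<^sup>2 \<le> a k * a (Suc (Suc k))"
    and \<rho>: "\<rho> > 0" and bound: "\<And>k. a k \<le> C * \<rho> ^ k"
  shows "a k \<le> \<rho> ^ k * a 0"
proof -
  have ratio: "a (Suc k) \<le> \<rho> * a k" for k
  proof (rule ccontr)
    assume "\<not> a (Suc k) \<le> \<rho> * a k"
    then have gt: "\<rho> * a k < a (Suc k)" by simp
    have "0 \<le> \<rho> * a k" using \<rho> nonneg[of k] by simp
    then have "0 < (a (Suc k))\<^sup>2" using gt by (intro zero_less_power) linarith
    then have "0 < a k * a (Suc (Suc k))" using convex[of k] by linarith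
    then have ak: "a k > 0" using nonneg[of k] by (simp add: zero_less_mult_iff)
    define r where "r = a (Suc k) / a k"
    have r: "\<rho> < r" using gt ak by (simp add: r_def field_simps)
    \<comment> \<open>From index k on every ratio is at least r, so r^j times \<open>a k\<close>
      stays below the exponential bound for all j, which fails once r exceeds
      \<open>\<rho>\<close>.\<close>
    have le: "(r / \<rho>) ^ j \<le> C * \<rho> ^ k / a k" for j
    proof -
      have "r ^ j * a (k + 0) \<le> a (k + j)"
        using nonneg convex r \<rho> ak
        by (intro log_convex_ge[of "\<lambda>j. a (k + j)"]) (auto simp: r_def)
      also have "\<dots> \<le> C * \<rho> ^ (k + j)" by (rule bound)
      finally show ?thesis using ak \<rho> by (simp add: power_divide power_add field_simps)
    qed
    have "1 < r / \<rho>" using r \<rho> by simp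
    then obtain j where "C * \<rho> ^ k / a k < (r / \<rho>) ^ j" using real_arch_pow by blast
    then show False using le[of j] by simp
  qed
  show ?thesis
  proof (induction k)
    case (Suc k)
    have "\<rho> * a k \<le> \<rho> ^ Suc k * a 0" using Suc \<rho> by (simp add: mult_left_mono)
    then show ?case using ratio[of k] by simp
  qed simp
qed

section \<open>The main estimates\<close>

lemma nat_floor_le_iff: "t \<ge> 0 \<Longrightarrow> k \<le> nat \<lfloor>t\<rfloor> \<longleftrightarrow> real k \<le> t"
  by (simp add: le_nat_iff le_floor_iff)

text \<open>Time u N^d measured in units of N^2.\<close>

lemma power_dim_split:
  assumes "CARD('d::finite) \<ge> 3" "N \<ge> 1"
  shows "u * real N ^ CARD('d) / (real N)\<^sup>2 = u * real N ^ (CARD('d) - 2)"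
proof -
  have "2 + (CARD('d) - 2) = CARD('d)" using assms by simp
  then have "real N ^ CARD('d) = (real N)\<^sup>2 * real N ^ (CARD('d) - 2)" by (metis power_add)
  then show ?thesis using assms by simp
qed

lemma return_times_not_too_small:
  assumes d3: "CARD('d::finite) \<ge> 3"
  shows "\<exists>b>0. \<exists>C>0. \<forall>c\<^sub>1\<ge>b. \<forall>u>0. \<forall>N\<ge>1.
      \<P>(X in (torus_walk N :: (nat \<Rightarrow> int ^ 'd) measure).
        ereal_of_enat (return_time N (nat \<lfloor>c\<^sub>1 * u * real N ^ (CARD('d) - 2)\<rfloor>) X) \<le> ereal (u * real N ^ CARD('d)))
      \<le> C * exp (- 1 * u * real N ^ (CARD('d) - 2))"
proof -
  obtain a l where a: "a \<ge> 0" and bound: "\<And>N n k. N \<ge> 1 \<Longrightarrow>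
    measure (torus_walk N :: (nat \<Rightarrow> int ^ 'd) measure) {X. k \<le> fst (cycle_state N (0, False) X n)}
      \<le> exp (a * real n / (real N)\<^sup>2) * exp l / 2 ^ k"
    using prob_many_returns_le[where 'd = 'd] by blast
  \<comment> \<open>With k of order b v, where v = u N^(d-2), the factor 2^(-k) beats exp (a v) by
    exp (-v). Any larger c_1 also works, which later leaves room for c_1 > c_2.\<close>
  define b where "b = (a + 1) / ln 2"
  have b: "b > 0" using a by (simp add: b_def)
  have "\<P>(X in (torus_walk N :: (nat \<Rightarrow> int ^ 'd) measure).
        ereal_of_enat (return_time N (nat \<lfloor>c\<^sub>1 * u * real N ^ (CARD('d) - 2)\<rfloor>) X) \<le> ereal (u * real N ^ CARD('d)))
      \<le> (2 * exp l) * exp (- 1 * u * real N ^ (CARD('d) - 2))"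
    if c1: "c\<^sub>1 \<ge> b" and u: "u > 0" and N: "N \<ge> 1" for c\<^sub>1 u :: real and N
  proof -
    define v where "v = u * real N ^ (CARD('d) - 2)"
    define t where "t = u * real N ^ CARD('d)"
    define k where "k = nat \<lfloor>c\<^sub>1 * u * real N ^ (CARD('d) - 2)\<rfloor>"
    define n where "n = nat \<lfloor>t\<rfloor>"
    have v: "v > 0" and t: "t > 0" using u N by (auto simp: v_def t_def)
    have "ereal_of_enat (return_time N k X) \<le> ereal t \<longleftrightarrow> k \<le> fst (cycle_state N (0, False) X n)"
      for X :: "nat \<Rightarrow> int ^ 'd"
    proof -
      have "ereal_of_enat e \<le> ereal t \<longleftrightarrow> e \<le> enat n" for e
        using t by (cases e) (auto simp: n_def nat_floor_le_iff)
      then show ?thesis by (simp only: return_time_le_iff)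
    qed
    then have "\<P>(X in (torus_walk N :: (nat \<Rightarrow> int ^ 'd) measure). ereal_of_enat (return_time N k X) \<le> ereal t)
        \<le> exp (a * real n / (real N)\<^sup>2) * exp l / 2 ^ k"
      using bound[OF N] by simp
    also have "\<dots> \<le> exp (a * v) * exp l / (exp ((a + 1) * v) / 2)"
    proof (intro frac_le mult_right_mono)
      have "real n \<le> t" using t by (simp add: n_def)
      then have "a * real n / (real N)\<^sup>2 \<le> a * t / (real N)\<^sup>2"
        using a by (intro divide_right_mono mult_left_mono) auto
      also have "\<dots> = a * v" using power_dim_split[OF d3 N, of "a * u"] by (simp add: t_def v_def mult.assoc)
      finally show "exp (a * real n / (real N)\<^sup>2) \<le> exp (a * v)" by simp
      have "b * v \<le> c\<^sub>1 * v" using c1 v by (intro mult_right_mono) auto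
      \<comment> \<open>The integer part loses at most 1, which costs the factor 2 in the
        constant.\<close>
      then have "b * v - 1 \<le> real k" unfolding k_def v_def by (simp add: mult.assoc) linarith
      then have "(b * v - 1) * ln 2 \<le> real k * ln 2" by (intro mult_right_mono) auto
      then have "(a + 1) * v - ln 2 \<le> real k * ln 2" by (simp add: b_def left_diff_distrib)
      then have "exp ((a + 1) * v - ln 2) \<le> exp (real k * ln 2)" by simp
      also have "exp (real k * ln 2) = 2 ^ k" by (simp add: exp_of_nat_mult)
      finally show "exp ((a + 1) * v) / 2 \<le> 2 ^ k" by (simp add: exp_diff)
    qed auto
    also have "\<dots> = (2 * exp l) * exp (- v)"
      by (simp add: exp_minus exp_add field_simps)
    finally show ?thesis by (simp add: k_def v_def t_def)
  qed
  then show ?thesis using b by (intro exI[of _ b] exI[of _ "2 * exp l"] conjI allI impI) auto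
qed

lemma return_times_not_too_large:
  assumes d3: "CARD('d::finite) \<ge> 3"
  shows "\<exists>b>0. \<exists>C>0. \<exists>c'>0. \<forall>c\<^sub>2>0. c\<^sub>2 \<le> b \<longrightarrow> (\<forall>u>0. \<forall>N\<ge>2.
      \<P>(X in (torus_walk N :: (nat \<Rightarrow> int ^ 'd) measure).
        ereal_of_enat (return_time N (nat \<lfloor>c\<^sub>2 * u * real N ^ (CARD('d) - 2)\<rfloor>) X) \<ge> ereal (u * real N ^ CARD('d)))
      \<le> C * exp (- c' * u * real N ^ (CARD('d) - 2)))"
proof -
  obtain s M where s: "s > 0" and M: "M > 1" and bound: "\<And>N n k. N \<ge> 2 \<Longrightarrow>
    measure (torus_walk N :: (nat \<Rightarrow> int ^ 'd) measure) {X. fst (cycle_state N (0, False) X n) < k}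
      \<le> M ^ Suc k * exp (- (s * real n / (real N)\<^sup>2))"
    using prob_few_returns_le[where 'd = 'd] by blast
  \<comment> \<open>Then M^k is at most exp (s v/2), so returns consume at most half of the decay
    exp (-s v).\<close>
  define b where "b = s / (2 * ln M)"
  have b: "b > 0" using s M by (simp add: b_def)
  have "\<P>(X in (torus_walk N :: (nat \<Rightarrow> int ^ 'd) measure).
        ereal_of_enat (return_time N (nat \<lfloor>c\<^sub>2 * u * real N ^ (CARD('d) - 2)\<rfloor>) X) \<ge> ereal (u * real N ^ CARD('d)))
      \<le> (M * exp s) * exp (- (s / 2) * u * real N ^ (CARD('d) - 2))"
    if c2: "0 < c\<^sub>2" "c\<^sub>2 \<le> b" and u: "u > 0" and N: "N \<ge> 2" for c\<^sub>2 u :: real and N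
  proof -
    interpret prob_space "torus_walk N :: (nat \<Rightarrow> int ^ 'd) measure"
      using N by (intro prob_space_torus_walk) simp
    define v where "v = u * real N ^ (CARD('d) - 2)"
    define t where "t = u * real N ^ CARD('d)"
    define k where "k = nat \<lfloor>c\<^sub>2 * u * real N ^ (CARD('d) - 2)\<rfloor>"
    \<comment> \<open>The largest integer strictly below t: a return time of at least t has not
      occurred by time n. The loss t - n is at most 1 and costs at most the factor exp s.\<close>
    define n where "n = nat (\<lceil>t\<rceil> - 1)"
    have v: "v > 0" and t: "t > 0" using u N by (auto simp: v_def t_def)
    have n: "real n < t" "t \<le> real n + 1" using t unfolding n_def by linarith+
    have "fst (cycle_state N (0, False) X n) < k" if "ereal t \<le> ereal_of_enat (return_time N k X)"
      for X :: "nat \<Rightarrow> int ^ 'd"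
    proof -
      have "\<not> return_time N k X \<le> enat n"
      proof
        assume "return_time N k X \<le> enat n"
        then have "ereal_of_enat (return_time N k X) \<le> ereal (real n)"
          by (cases "return_time N k X") auto
        with that have "ereal t \<le> ereal (real n)" by (rule order_trans)
        then show False using n by simp
      qed
      then show ?thesis by (simp add: return_time_le_iff)
    qed
    then have "\<P>(X in (torus_walk N :: (nat \<Rightarrow> int ^ 'd) measure). ereal_of_enat (return_time N k X) \<ge> ereal t)
        \<le> measure (torus_walk N :: (nat \<Rightarrow> int ^ 'd) measure) {X. fst (cycle_state N (0, False) X n) < k}"
      using measurable_sets[OF measurable_cycle_state[of N "(0, False)" n], of "{st. fst st < k}"]
      by (intro finite_measure_mono) (auto simp: vimage_def space_PiM)
    also have "\<dots> \<le> M ^ Suc k * exp (- (s * real n / (real N)\<^sup>2))"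
      by (rule bound[OF N])
    also have "\<dots> \<le> (M * exp (s * v / 2)) * exp (s - s * v)"
    proof (intro mult_mono)
      have "real k \<le> c\<^sub>2 * v" using c2 v unfolding k_def v_def by (simp add: mult.assoc)
      also have "\<dots> \<le> b * v" using c2 v by (intro mult_right_mono) auto
      finally have "real k * ln M \<le> b * v * ln M" using M by (intro mult_right_mono) auto
      also have "\<dots> = s * v / 2" using M by (simp add: b_def)
      finally have "exp (real k * ln M) \<le> exp (s * v / 2)" by simp
      moreover have "exp (real k * ln M) = M ^ k" using M by (simp add: exp_of_nat_mult)
      ultimately show "M ^ Suc k \<le> M * exp (s * v / 2)" using M by simp
      have "s * (t - 1) / (real N)\<^sup>2 \<le> s * real n / (real N)\<^sup>2"
        using n s by (intro divide_right_mono mult_left_mono) auto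
      moreover have "s * (t - 1) / (real N)\<^sup>2 = s * v - s / (real N)\<^sup>2"
        using power_dim_split[OF d3, of N "s * u"] N
        by (simp add: t_def v_def right_diff_distrib diff_divide_distrib mult.assoc)
      moreover have "s / (real N)\<^sup>2 \<le> s / 1"
        using s N by (intro divide_left_mono) (auto simp: one_le_power)
      ultimately show "exp (- (s * real n / (real N)\<^sup>2)) \<le> exp (s - s * v)" by simp
    qed (use M in auto)
    also have "\<dots> = (M * exp s) * exp (- (s / 2) * v)"
      by (simp add: mult.assoc exp_add[symmetric])
    finally show ?thesis by (simp add: k_def v_def t_def mult.assoc)
  qed
  then show ?thesis
    using b s M by (intro exI[of _ b] exI[of _ "M * exp s"] exI[of _ "s / 2"] conjI allI impI) auto
qed

lemma prob_origin_not_visited: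
  assumes N: "N \<ge> 1" and t: "t \<ge> 0"
  shows "\<P>(X in (torus_walk N :: (nat \<Rightarrow> int ^ 'd::finite) measure). 0 \<notin> visited t X)
    = avoid_mass TYPE('d) N (nat \<lfloor>t\<rfloor>) / real N ^ CARD('d)"
proof -
  have "{X \<in> space (torus_walk N :: (nat \<Rightarrow> int ^ 'd) measure). 0 \<notin> visited t X} = {X. \<forall>k\<le>nat \<lfloor>t\<rfloor>. X k \<noteq> 0}"
    using t by (auto simp: visited_def nat_floor_le_iff)
  then show ?thesis using measure_torus_walk_avoid[OF N] by (simp add: avoid_mass_def)
qed

lemma avoid_mass_even_log_convex:
  assumes "N \<ge> 1"
  shows "(avoid_mass TYPE('d::finite) N (2 * Suc k))\<^sup>2
    \<le> avoid_mass TYPE('d) N (2 * k) * avoid_mass TYPE('d) N (2 * Suc (Suc k))"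
  using avoid_mass_log_convex[OF assms, of k "Suc (Suc k)", where 'd = 'd] by (simp add: mult_2)

lemma prob_origin_not_visited_le:
  assumes d3: "CARD('d::finite) \<ge> 3"
  shows "\<exists>M>0. \<forall>N\<ge>1. \<forall>t\<ge>0.
      \<P>(X in (torus_walk N :: (nat \<Rightarrow> int ^ 'd) measure). 0 \<notin> visited t X)
        \<le> exp (- (t - 2) / (M * real N ^ CARD('d)))"
proof -
  obtain M where M: "M \<ge> 2" and bound: "\<And>N n. N \<ge> 1 \<Longrightarrow> avoid_mass TYPE('d) N n
    \<le> M * real N ^ CARD('d) * (1 - 1 / (M * real N ^ CARD('d))) ^ n"
    using avoid_mass_le_exponential[OF d3] by blast
  have "\<P>(X in (torus_walk N :: (nat \<Rightarrow> int ^ 'd) measure). 0 \<notin> visited t X)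
        \<le> exp (- (t - 2) / (M * real N ^ CARD('d)))" if N: "N \<ge> 1" and t: "t \<ge> 0" for N t
  proof -
    define D where "D = real N ^ CARD('d)"
    define \<rho> where "\<rho> = 1 - 1 / (M * D)"
    define n where "n = nat \<lfloor>t\<rfloor>"
    \<comment> \<open>Log-convexity holds along even times, so n is rounded down; the two roundings
      give 2m at least t - 2.\<close>
    define m where "m = n div 2"
    have D: "D \<ge> 1" using N by (simp add: D_def one_le_power)
    have "2 * 1 \<le> M * D" using M D by (intro mult_mono) auto
    then have \<rho>: "\<rho> > 0" by (simp add: \<rho>_def field_simps)
    have "avoid_mass TYPE('d) N (2 * m) \<le> (\<rho>\<^sup>2) ^ m * avoid_mass TYPE('d) N (2 * 0)"
    proof (rule log_convex_le[of "\<lambda>k. avoid_mass TYPE('d) N (2 * k)"])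
      show "avoid_mass TYPE('d) N (2 * k) \<le> (M * D) * (\<rho>\<^sup>2) ^ k" for k
        using bound[OF N, of "2 * k"] by (simp add: D_def \<rho>_def power_mult)
      show "(avoid_mass TYPE('d) N (2 * Suc k))\<^sup>2
          \<le> avoid_mass TYPE('d) N (2 * k) * avoid_mass TYPE('d) N (2 * Suc (Suc k))" for k
        by (rule avoid_mass_even_log_convex[OF N])
    qed (use \<rho> in \<open>auto simp: avoid_mass_nonneg\<close>)
    also have "\<dots> \<le> (\<rho>\<^sup>2) ^ m * D"
      using \<rho> N by (intro mult_left_mono) (auto simp: avoid_mass_0 D_def)
    finally have "avoid_mass TYPE('d) N n \<le> (\<rho>\<^sup>2) ^ m * D"
      using avoid_mass_antimono[of "2 * m" n N, where 'd = 'd] by (simp add: m_def)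
    then have "avoid_mass TYPE('d) N n / D \<le> \<rho> ^ (2 * m)"
      using D by (simp add: pos_divide_le_eq power_mult)
    also have "\<dots> \<le> exp (- (1 / (M * D))) ^ (2 * m)"
      using \<rho> exp_ge_add_one_self[of "- (1 / (M * D))"] by (intro power_mono) (auto simp: \<rho>_def)
    also have "\<dots> = exp (- real (2 * m) / (M * D))"
      unfolding exp_of_nat_mult[symmetric] by simp
    also have "\<dots> \<le> exp (- (t - 2) / (M * D))"
    proof -
      have "t - 2 \<le> real (2 * m)" unfolding m_def n_def by linarith
      then have "- real (2 * m) / (M * D) \<le> - (t - 2) / (M * D)"
        using M D by (intro divide_right_mono) auto
      then show ?thesis by simp
    qed
    finally show ?thesis
      using prob_origin_not_visited[OF N t, where 'd = 'd] by (simp add: n_def D_def)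
  qed
  then show ?thesis using M by (intro exI[of _ M] conjI allI impI) auto
qed

text \<open>Of the initial mass D - 1, two steps remove at most 2, so the first ratio along even
  times is at least 1 - 2/(D - 1), and log-convexity propagates it to all later ones.\<close>

lemma prob_origin_not_visited_ge:
  assumes N: "N \<ge> 1" and D5: "real N ^ CARD('d::finite) \<ge> 5" and t: "t \<ge> 0"
  defines "D \<equiv> real N ^ CARD('d)"
  shows "(1 - 1 / D) * exp (- 4 / (D - 1) * (t / 2 + 1))
    \<le> \<P>(X in (torus_walk N :: (nat \<Rightarrow> int ^ 'd) measure). 0 \<notin> visited t X)"
proof -
  define y where "y = 2 / (D - 1)"
  define n where "n = nat \<lfloor>t\<rfloor>"
  \<comment> \<open>Rounded up here: the even time 2m must not lie before n.\<close>
  define m where "m = Suc (n div 2)"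
  have D: "D \<ge> 5" using D5 by (simp add: D_def)
  have y: "0 \<le> y" "y \<le> 1 / 2" using D by (auto simp: y_def field_simps)
  have A0: "avoid_mass TYPE('d) N 0 = D - 1" using avoid_mass_0[OF N] by (simp add: D_def)
  have "D - 3 \<le> avoid_mass TYPE('d) N 2"
    using avoid_mass_Suc_ge[OF N, of 0, where 'd = 'd] avoid_mass_Suc_ge[OF N, of 1, where 'd = 'd] A0
    by (simp add: numeral_2_eq_2)
  moreover have "(1 - y) * (D - 1) = D - 3" using D by (simp add: y_def field_simps)
  ultimately have start: "(1 - y) * avoid_mass TYPE('d) N (2 * 0) \<le> avoid_mass TYPE('d) N (2 * 1)"
    by (simp add: A0)
  \<comment> \<open>The assumption D at least 5 gives y at most 1/2, the range in which ln (1 - y)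
    is at least -2y.\<close>
  have "- 2 * y \<le> - y - 2 * y\<^sup>2" using y mult_left_mono[of y "1/2" y] by (simp add: power2_eq_square)
  also have "\<dots> \<le> ln (1 - y)" using y by (rule ln_one_minus_pos_lower_bound)
  finally have "exp (- 2 * y) \<le> 1 - y" using y by (subst (asm) ln_ge_iff) auto
  then have "exp (- 2 * y) ^ m \<le> (1 - y) ^ m" by (intro power_mono) auto
  moreover have "exp (- 4 / (D - 1) * (t / 2 + 1)) \<le> exp (- 2 * y) ^ m"
  proof -
    have "real m \<le> t / 2 + 1" using t unfolding m_def n_def by linarith
    then have "4 / (D - 1) * real m \<le> 4 / (D - 1) * (t / 2 + 1)"
      using D by (intro mult_left_mono) auto
    then show ?thesis unfolding exp_of_nat_mult[symmetric] by (simp add: y_def mult.commute)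
  qed
  ultimately have "exp (- 4 / (D - 1) * (t / 2 + 1)) * (D - 1) \<le> (1 - y) ^ m * (D - 1)"
    using D by (intro mult_right_mono) auto
  also have "\<dots> \<le> avoid_mass TYPE('d) N (2 * m)"
    using log_convex_ge[of "\<lambda>k. avoid_mass TYPE('d) N (2 * k)", OF avoid_mass_nonneg
        avoid_mass_even_log_convex[OF N] _ start, of m] y A0 by simp
  also have "\<dots> \<le> avoid_mass TYPE('d) N n"
    by (rule avoid_mass_antimono) (simp add: m_def)
  finally have "exp (- 4 / (D - 1) * (t / 2 + 1)) * (D - 1) / D \<le> avoid_mass TYPE('d) N n / D"
    using D by (intro divide_right_mono) auto
  moreover have "exp (- 4 / (D - 1) * (t / 2 + 1)) * (D - 1) / D = (1 - 1 / D) * exp (- 4 / (D - 1) * (t / 2 + 1))"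
    using D by (simp add: field_simps)
  ultimately show ?thesis
    using prob_origin_not_visited[OF N t, where 'd = 'd] by (simp add: n_def D_def)
qed

lemma filterlim_power_dim: "filterlim (\<lambda>N. real N ^ CARD('d::finite)) at_top sequentially"
  by (rule filterlim_pow_at_top[OF zero_less_card_finite filterlim_real_sequentially])

theorem proposition1p1:
  assumes "CARD('d::finite) \<ge> 3"
  shows "(\<exists>c\<^sub>1 c\<^sub>2 :: real. c\<^sub>1 > c\<^sub>2 \<and> c\<^sub>2 > 0 \<and>
      (\<exists>c c' :: real. c > 0 \<and> c' > 0 \<and>
        (\<forall>(u::real) (N::nat). u > 0 \<longrightarrow> N \<ge> 1 \<longrightarrow>
          \<P>(X in (torus_walk N :: (nat \<Rightarrow> int ^ 'd) measure).
             ereal_of_enat (return_time N (nat \<lfloor>c\<^sub>1 * u * real N ^ (CARD('d) - 2)\<rfloor>) X)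
               \<le> ereal (u * real N ^ CARD('d)))
          \<le> c * exp (- c' * u * real N ^ (CARD('d) - 2)))) \<and>
      (\<exists>c c' :: real. c > 0 \<and> c' > 0 \<and>
        (\<forall>(u::real) (N::nat). u > 0 \<longrightarrow> N \<ge> 2 \<longrightarrow>
          \<P>(X in (torus_walk N :: (nat \<Rightarrow> int ^ 'd) measure).
             ereal_of_enat (return_time N (nat \<lfloor>c\<^sub>2 * u * real N ^ (CARD('d) - 2)\<rfloor>) X)
               \<ge> ereal (u * real N ^ CARD('d)))
          \<le> c * exp (- c' * u * real N ^ (CARD('d) - 2))))) \<and>
    (\<exists>c c' :: real. c > 0 \<and> c' > 0 \<and>
      (\<forall>u::real. u > 0 \<longrightarrow>
        (let p = (\<lambda>N::nat. \<P>(X in (torus_walk N :: (nat \<Rightarrow> int ^ 'd) measure).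
                     0 \<notin> visited (u * real N ^ CARD('d)) X))
         in ereal (exp (- c * u)) \<le> liminf (\<lambda>N. ereal (p N)) \<and>
            liminf (\<lambda>N. ereal (p N)) \<le> limsup (\<lambda>N. ereal (p N)) \<and>
            limsup (\<lambda>N. ereal (p N)) \<le> ereal (exp (- c' * u)))))"
proof (rule conjI)
  obtain b\<^sub>1 C\<^sub>1 :: real where 1: "b\<^sub>1 > 0" "C\<^sub>1 > 0" and small: "\<forall>c\<^sub>1\<ge>b\<^sub>1. \<forall>u>0. \<forall>N\<ge>1.
      \<P>(X in (torus_walk N :: (nat \<Rightarrow> int ^ 'd) measure).
        ereal_of_enat (return_time N (nat \<lfloor>c\<^sub>1 * u * real N ^ (CARD('d) - 2)\<rfloor>) X) \<le> ereal (u * real N ^ CARD('d)))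
      \<le> C\<^sub>1 * exp (- 1 * u * real N ^ (CARD('d) - 2))"
    using return_times_not_too_small[OF assms] by blast
  obtain b\<^sub>2 C\<^sub>2 s :: real where 2: "b\<^sub>2 > 0" "C\<^sub>2 > 0" "s > 0" and large: "\<forall>c\<^sub>2>0. c\<^sub>2 \<le> b\<^sub>2 \<longrightarrow> (\<forall>u>0. \<forall>N\<ge>2.
      \<P>(X in (torus_walk N :: (nat \<Rightarrow> int ^ 'd) measure).
        ereal_of_enat (return_time N (nat \<lfloor>c\<^sub>2 * u * real N ^ (CARD('d) - 2)\<rfloor>) X) \<ge> ereal (u * real N ^ CARD('d)))
      \<le> C\<^sub>2 * exp (- s * u * real N ^ (CARD('d) - 2)))"
    using return_times_not_too_large[OF assms] by blast
  show "\<exists>c\<^sub>1 c\<^sub>2 :: real. c\<^sub>1 > c\<^sub>2 \<and> c\<^sub>2 > 0 \<and>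
      (\<exists>c c' :: real. c > 0 \<and> c' > 0 \<and>
        (\<forall>(u::real) (N::nat). u > 0 \<longrightarrow> N \<ge> 1 \<longrightarrow>
          \<P>(X in (torus_walk N :: (nat \<Rightarrow> int ^ 'd) measure).
             ereal_of_enat (return_time N (nat \<lfloor>c\<^sub>1 * u * real N ^ (CARD('d) - 2)\<rfloor>) X)
               \<le> ereal (u * real N ^ CARD('d)))
          \<le> c * exp (- c' * u * real N ^ (CARD('d) - 2)))) \<and>
      (\<exists>c c' :: real. c > 0 \<and> c' > 0 \<and>
        (\<forall>(u::real) (N::nat). u > 0 \<longrightarrow> N \<ge> 2 \<longrightarrow>
          \<P>(X in (torus_walk N :: (nat \<Rightarrow> int ^ 'd) measure).
             ereal_of_enat (return_time N (nat \<lfloor>c\<^sub>2 * u * real N ^ (CARD('d) - 2)\<rfloor>) X)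
               \<ge> ereal (u * real N ^ CARD('d)))
          \<le> c * exp (- c' * u * real N ^ (CARD('d) - 2))))"
  \<comment> \<open>Every c_1 above the first threshold is admissible, so adding the second
    threshold enforces c_1 > c_2.\<close>
  proof (rule exI[of _ "b\<^sub>1 + b\<^sub>2"], rule exI[of _ b\<^sub>2], intro conjI)
    show "b\<^sub>2 < b\<^sub>1 + b\<^sub>2" "0 < b\<^sub>2" using 1 2 by auto
    show "\<exists>c c' :: real. c > 0 \<and> c' > 0 \<and>
        (\<forall>(u::real) (N::nat). u > 0 \<longrightarrow> N \<ge> 1 \<longrightarrow>
          \<P>(X in (torus_walk N :: (nat \<Rightarrow> int ^ 'd) measure).
             ereal_of_enat (return_time N (nat \<lfloor>(b\<^sub>1 + b\<^sub>2) * u * real N ^ (CARD('d) - 2)\<rfloor>) X)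
               \<le> ereal (u * real N ^ CARD('d)))
          \<le> c * exp (- c' * u * real N ^ (CARD('d) - 2)))"
      using 1 2(1) small by (intro exI[of _ C\<^sub>1] exI[of _ 1] conjI allI impI) auto
    show "\<exists>c c' :: real. c > 0 \<and> c' > 0 \<and>
        (\<forall>(u::real) (N::nat). u > 0 \<longrightarrow> N \<ge> 2 \<longrightarrow>
          \<P>(X in (torus_walk N :: (nat \<Rightarrow> int ^ 'd) measure).
             ereal_of_enat (return_time N (nat \<lfloor>b\<^sub>2 * u * real N ^ (CARD('d) - 2)\<rfloor>) X)
               \<ge> ereal (u * real N ^ CARD('d)))
          \<le> c * exp (- c' * u * real N ^ (CARD('d) - 2)))"
      using 2 large by (intro exI[of _ C\<^sub>2] exI[of _ s] conjI allI impI) auto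
  qed
next
  obtain M :: real where M: "M > 0" "\<forall>N\<ge>1. \<forall>t\<ge>0.
      \<P>(X in (torus_walk N :: (nat \<Rightarrow> int ^ 'd) measure). 0 \<notin> visited t X)
        \<le> exp (- (t - 2) / (M * real N ^ CARD('d)))"
    using prob_origin_not_visited_le[OF assms] by blast
  show "\<exists>c c' :: real. c > 0 \<and> c' > 0 \<and>
      (\<forall>u::real. u > 0 \<longrightarrow>
        (let p = (\<lambda>N::nat. \<P>(X in (torus_walk N :: (nat \<Rightarrow> int ^ 'd) measure).
                     0 \<notin> visited (u * real N ^ CARD('d)) X))
         in ereal (exp (- c * u)) \<le> liminf (\<lambda>N. ereal (p N)) \<and>
            liminf (\<lambda>N. ereal (p N)) \<le> limsup (\<lambda>N. ereal (p N)) \<and>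
            limsup (\<lambda>N. ereal (p N)) \<le> ereal (exp (- c' * u))))"
  \<comment> \<open>The constants are the limits of the finite-N exponents: 4/(D - 1) times (u D/2 +
    1) tends to 2u, and (u D - 2)/(M D) tends to u/M, as D = N^d grows.\<close>
  proof (rule exI[of _ 2], rule exI[of _ "1 / M"], intro conjI allI impI)
    fix u :: real assume u: "u > 0"
    define p where "p N = \<P>(X in (torus_walk N :: (nat \<Rightarrow> int ^ 'd) measure).
      0 \<notin> visited (u * real N ^ CARD('d)) X)" for N
    let ?D = "\<lambda>N. real N ^ CARD('d)"
    define lo where "lo D = (1 - 1 / D) * exp (- 4 / (D - 1) * (u * D / 2 + 1))" for D
    define hi where "hi D = exp (- (u * D - 2) / (M * D))" for D
    have "(lo \<longlongrightarrow> exp (- 2 * u)) at_top" unfolding lo_def by real_asymp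
    then have lo: "(\<lambda>N. ereal (lo (?D N))) \<longlonglongrightarrow> ereal (exp (- 2 * u))"
      by (intro tendsto_ereal filterlim_compose[OF _ filterlim_power_dim])
    have "(hi \<longlongrightarrow> exp (- (u * inverse M))) at_top"
      unfolding hi_def using M(1) by real_asymp
    then have "(hi \<longlongrightarrow> exp (- (1 / M) * u)) at_top" by (simp add: divide_inverse mult.commute)
    then have hi: "(\<lambda>N. ereal (hi (?D N))) \<longlonglongrightarrow> ereal (exp (- (1 / M) * u))"
      by (intro tendsto_ereal filterlim_compose[OF _ filterlim_power_dim])
    have "\<forall>\<^sub>F N in sequentially. ?D N \<ge> 5"
      using filterlim_power_dim unfolding filterlim_at_top by blast
    then have ev_lo: "\<forall>\<^sub>F N in sequentially. ereal (lo (?D N)) \<le> ereal (p N)"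
      using eventually_ge_at_top[of 1]
    proof eventually_elim
      case (elim N)
      then show ?case
        using prob_origin_not_visited_ge[of N "u * ?D N", where 'd = 'd] u by (simp add: lo_def p_def)
    qed
    have ev_hi: "\<forall>\<^sub>F N in sequentially. ereal (p N) \<le> ereal (hi (?D N))"
      using eventually_ge_at_top[of 1]
    proof eventually_elim
      case (elim N)
      then show ?case using M(2)[rule_format, of N "u * ?D N"] u by (simp add: hi_def p_def)
    qed
    have "ereal (exp (- 2 * u)) \<le> liminf (\<lambda>N. ereal (p N))"
      using Liminf_mono[OF ev_lo] lim_imp_Liminf[OF _ lo] by simp
    moreover have "limsup (\<lambda>N. ereal (p N)) \<le> ereal (exp (- (1 / M) * u))"
      using Limsup_mono[OF ev_hi] lim_imp_Limsup[OF _ hi] by simp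
    moreover have "liminf (\<lambda>N. ereal (p N)) \<le> limsup (\<lambda>N. ereal (p N))"
      by (rule Liminf_le_Limsup) simp
    ultimately show "let p = (\<lambda>N::nat. \<P>(X in (torus_walk N :: (nat \<Rightarrow> int ^ 'd) measure).
                     0 \<notin> visited (u * real N ^ CARD('d)) X))
         in ereal (exp (- 2 * u)) \<le> liminf (\<lambda>N. ereal (p N)) \<and>
            liminf (\<lambda>N. ereal (p N)) \<le> limsup (\<lambda>N. ereal (p N)) \<and>
            limsup (\<lambda>N. ereal (p N)) \<le> ereal (exp (- (1 / M) * u))"
      by (simp add: p_def)
  qed (use M in auto)
qed

end
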